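(* Let $(p_n)_{n=1}^\infty$ be a sequence of complex polynomials with $\deg p_1\geq 1$ and $\deg p_n\geq 2$ for $n\geq 2$. Define $\alpha:=\limsup_{n\to\infty}\frac{1}{\deg p_n}$. Assume that there exist an $r>0$ and a function $h:\mathbb{C}\to\mathbb{R}$ satisfying $h(z)-\alpha\log|z|\to\infty$ as $|z|\to\infty$ such that (i) $\bigcup_{n=1}^\infty p_n^{-1}(0)\subset\overline{\mathbb{D}}(0,r)$; (ii) there exists $N>1$ such that for all $n\geq N$ and all $\zeta\in\mathbb{C}\setminus\overline{\mathbb{D}}(0,r)$: $\frac{1}{\deg p_n}\log^+|p_n(\zeta)|>h(\zeta)$; (iii) there is a non-empty open set $D\subset\mathbb{C}$ such that $\sup_{n\geq 1}\frac{1}{\deg p_n}\log^+|p_n(z)|<+\infty$ for every $z\in D$. Then for every compact, polynomially convex and regular set $E\subset\mathbb{C}$ the sequence of sets $\left((p_n\circ\dots\circ p_1)^{-1}(E)\right)_{n=1}^\infty$ is convergent in Klimek's metric $\Gamma$ to the limit $\mathcal{K}[(p_n)_{n=1}^\infty]$, which is independent of $E$. In particular $\mathcal{K}[(p_n)_{n=1}^\infty]$ is non-empty, compact, regular and polynomially convex.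
   Context: Notation: $\overline{\mathbb{D}}(a,R)=\{z\in\mathbb{C}:|z-a|\leq R\}$ and $\log^+ x=\max\{0,\log x\}$ (with $\log^+0=0$). For compact $K\subset\mathbb{C}$ let $D_\infty^K$ be the unbounded component of $\mathbb{C}\setminus K$ and let $\widehat K=\{z\in\mathbb{C}: |p(z)|\leq\sup_K|p| \text{ for all polynomials } p\}=\mathbb{C}\setminus D_\infty^K$. $K$ is polynomially convex if $K=\widehat K$ (equivalently, $\mathbb{C}\setminus K$ is connected). The Green function (with pole at infinity) of an unbounded domain $D\subset\mathbb{C}$ is, if it exists, the (unique) function $g_D:D\to\mathbb{R}$ that is harmonic and positive in $D$, satisfies $g_D(z)\to 0$ as $z\to\partial D$, and for which $g_D(z)-\log|z|$ tends to a finite number as $z\to\infty$. A compact set $K$ is regular if $g_{D_\infty^K}$ exists; then $g_K:\mathbb{C}\to\mathbb{R}$ is defined by $g_K=g_{D_\infty^K}$ on $D_\infty^K$ and $g_K=0$ on $\widehat K$. $\mathcal{R}$ denotes the family of all compact, regular, polynomially convex subsets of $\mathbb{C}$. Klimek's metric on $\mathcal{R}$ is $\Gamma(E,F)=\sup_{z\in\mathbb{C}}|g_E(z)-g_F(z)|$; $(\mathcal{R},\Gamma)$ is a complete metric space, and $P^{-1}(E)\in\mathcal{R}$ for every $E\in\mathcal{R}$ and every non-constant polynomial $P$. The (non-autonomous) filled Julia set of $(p_n)_{n=1}^\infty$ is $\mathcal{K}[(p_n)_{n=1}^\infty]=\left\{z\in\mathbb{C}: \left((p_n\circ\dots\circ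 p_1)(z)\right)_{n=1}^\infty \text{ is bounded}\right\}$. *)

theory Defs
  imports
    "HOL-Complex_Analysis.Complex_Analysis"
    "HOL-Computational_Algebra.Polynomial"
begin

text \<open>Since \<^prop>\<open>ln 0 = (0::real)\<close>, this includes the convention that the value at 0 is 0.\<close>

definition log_plus :: "real \<Rightarrow> real" where
  "log_plus x = max 0 (ln x)"

text \<open>Harmonic functions are twice continuously differentiable with vanishing Laplacian;
  \<open>ux\<close>, \<open>uy\<close>, \<open>uxx\<close>, ... are the partial derivatives with respect to the real and imaginary
  part of the variable.\<close>

definition harmonic_on :: "(complex \<Rightarrow> real) \<Rightarrow> complex set \<Rightarrow> bool" where
  "harmonic_on u S \<longleftrightarrow> open S \<and>
     (\<exists>ux uy uxx uxy uyx uyy.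
        (\<forall>z\<in>S. (u has_derivative (\<lambda>v. ux z * Re v + uy z * Im v)) (at z)) \<and>
        (\<forall>z\<in>S. (ux has_derivative (\<lambda>v. uxx z * Re v + uxy z * Im v)) (at z)) \<and>
        (\<forall>z\<in>S. (uy has_derivative (\<lambda>v. uyx z * Re v + uyy z * Im v)) (at z)) \<and>
        continuous_on S uxx \<and> continuous_on S uxy \<and>
        continuous_on S uyx \<and> continuous_on S uyy \<and>
        (\<forall>z\<in>S. uxx z + uyy z = 0))"

text \<open>Only the values of \<open>g\<close> on \<open>D\<close> matter here.\<close>

definition is_green_function :: "complex set \<Rightarrow> (complex \<Rightarrow> real) \<Rightarrow> bool" where
  "is_green_function D g \<longleftrightarrow>
     harmonic_on g D \<and>
     (\<forall>z\<in>D. g z > 0) \<and>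
     (\<forall>w\<in>frontier D. (g \<longlongrightarrow> 0) (at w within D)) \<and>
     (\<exists>c. ((\<lambda>z. g z - ln (norm z)) \<longlongrightarrow> c) (inf at_infinity (principal D)))"

text \<open>For compact \<open>K\<close> in the plane, \<^term>\<open>outside K\<close> is the unbounded component of the
  complement of \<open>K\<close>. For \<open>K = {}\<close> there is no Green function, so the empty set is not regular.\<close>

definition regular_compact :: "complex set \<Rightarrow> bool" where
  "regular_compact K \<longleftrightarrow> compact K \<and> (\<exists>g. is_green_function (outside K) g)"

text \<open>The Green function is unique on \<^term>\<open>outside K\<close>, so the values below do not depend on the
  choice made by \<open>SOME\<close>.\<close>

definition green :: "complex set \<Rightarrow> complex \<Rightarrow> real" where
  "green K z = (if z \<in> outside K then (SOME g. is_green_function (outside K) g) z else 0)"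

text \<open>For \<open>K = {}\<close> the supremum is an unspecified real number; as all constant polynomials are
  admitted, the hull of the empty set is still empty.\<close>

definition polynomial_hull :: "complex set \<Rightarrow> complex set" where
  "polynomial_hull K = {z. \<forall>q :: complex poly. norm (poly q z) \<le> (SUP w\<in>K. norm (poly q w))}"

definition polynomially_convex :: "complex set \<Rightarrow> bool" where
  "polynomially_convex K \<longleftrightarrow> compact K \<and> K = polynomial_hull K"

definition klimek_family :: "complex set set" where
  "klimek_family = {K. compact K \<and> regular_compact K \<and> polynomially_convex K}"

text \<open>For members of \<^term>\<open>klimek_family\<close> the difference of the Green functions is bounded, so the
  real-valued supremum is the genuine one.\<close>

definition klimek_dist :: "complex set \<Rightarrow> complex set \<Rightarrow> real" where
  "klimek_dist E F = (SUP z. \<bar>green E z - green F z\<bar>)"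

text \<open>The composition of \<open>p 1\<close>, ..., \<open>p n\<close>, with \<open>p 1\<close> applied first; \<open>p 0\<close> is never used.\<close>

primrec poly_iter :: "(nat \<Rightarrow> complex poly) \<Rightarrow> nat \<Rightarrow> complex \<Rightarrow> complex" where
  "poly_iter p 0 z = z"
| "poly_iter p (Suc n) z = poly (p (Suc n)) (poly_iter p n z)"

definition filled_julia :: "(nat \<Rightarrow> complex poly) \<Rightarrow> complex set" where
  "filled_julia p = {z. bounded ((\<lambda>n. poly_iter p n z) ` {1..})}"

text \<open>Convergence of the sequence \<open>A 1, A 2, ...\<close> to \<open>L\<close> in the metric space formed by
  \<^term>\<open>klimek_family\<close> with \<^term>\<open>klimek_dist\<close>; membership of all the sets in the space is part
  of it.\<close>

definition klimek_converges :: "(nat \<Rightarrow> complex set) \<Rightarrow> complex set \<Rightarrow> bool" where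
  "klimek_converges A L \<longleftrightarrow>
     (\<forall>n\<ge>1. A n \<in> klimek_family) \<and> L \<in> klimek_family \<and>
     (\<lambda>n. klimek_dist (A n) L) \<longlonglongrightarrow> 0"

end

theory Submission
  imports Defs "HOL-Computational_Algebra.Fundamental_Theorem_Algebra"
begin

text \<open>The proof follows the Green functions of the preimages of one large disc.

  The zeros of all \<open>p n\<close> lie in the disc of radius \<open>r\<close>, so outside it the size of
  \<open>p n\<close> is governed by its leading coefficient and its degree \<open>d n\<close>. Boundedness on an open set gives,
  by Baire's theorem and Cauchy's estimate, an upper bound for \<open>\<bar>lead_coeff (p n)\<bar>\<^bsup>1/d n\<^esup>\<close>, and the lower
  bound on \<open>p n\<close> at one point with \<open>h \<zeta> > 0\<close> bounds this quantity away from 0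
  (\<open>lead_coeff_bounds\<close>).

  Consequently there are constants \<open>R\<close> and \<open>M\<close> such that, for \<open>L w = ln (max 1 (\<bar>w\<bar>/R))\<close> and \<open>n \<ge> 2\<close>,
  \<open>L w \<le> L (p n w) / d n \<le> L w + M\<close> for all \<open>w\<close> (\<open>disc_green_poly_ge\<close>, \<open>disc_green_poly_le\<close>). Let
  \<open>P n\<close> be the composition of \<open>p 1, ..., p n\<close> and \<open>D n\<close> its degree, which is at least \<open>2\<^bsup>n-1\<^esup>\<close>. Then
  \<open>g n = L (P n) / D n\<close> increases with \<open>n\<close>, with increments at most \<open>M / D n\<close>, and converges uniformly
  on the plane to a continuous function, the escape rate. It vanishes exactly on the filled Julia set
  (\<open>filled_julia_eq\<close>), and it is harmonic off this set because locally it is the logarithm of the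
  modulus of a holomorphic function, obtained from branches of \<open>(P n / R)\<^bsup>1/D n\<^esup>\<close> by Montel's theorem
  (\<open>escape_rate_locally_ln_norm\<close>). So it is the Green function of the filled Julia set, which is
  therefore regular.

  For arbitrary \<open>E\<close> the Green function of \<open>P n -` E\<close> is that of \<open>E\<close> composed with \<open>P n\<close> and divided by
  \<open>D n\<close>. It differs from \<open>g n\<close> by at most a constant over \<open>D n\<close>, because the Green function of \<open>E\<close>
  differs from \<open>L\<close> by a bounded amount; hence all \<open>E\<close> lead to the same limit. To identify the Green
  functions that are chosen by \<open>SOME\<close>, uniqueness is derived from a maximum principle for harmonic
  functions (\<open>harmonic_on_maximum_principle\<close>, \<open>extended_green_unique\<close>).\<close>

section \<open>Harmonic functions\<close>

lemma harmonic_on_open: "harmonic_on u S \<Longrightarrow> open S"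
  by (simp add: harmonic_on_def)

lemma harmonic_onI:
  assumes "open S"
    and "\<And>z. z \<in> S \<Longrightarrow> (u has_derivative (\<lambda>v. ux z * Re v + uy z * Im v)) (at z)"
    and "\<And>z. z \<in> S \<Longrightarrow> (ux has_derivative (\<lambda>v. uxx z * Re v + uxy z * Im v)) (at z)"
    and "\<And>z. z \<in> S \<Longrightarrow> (uy has_derivative (\<lambda>v. uyx z * Re v + uyy z * Im v)) (at z)"
    and "continuous_on S uxx" "continuous_on S uxy" "continuous_on S uyx" "continuous_on S uyy"
    and "\<And>z. z \<in> S \<Longrightarrow> uxx z + uyy z = 0"
  shows "harmonic_on u S"
  unfolding harmonic_on_def using assms by blast

lemma harmonic_onE:
  assumes "harmonic_on u S"
  obtains ux uy uxx uxy uyx uyy where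
    "\<And>z. z \<in> S \<Longrightarrow> (u has_derivative (\<lambda>v. ux z * Re v + uy z * Im v)) (at z)"
    "\<And>z. z \<in> S \<Longrightarrow> (ux has_derivative (\<lambda>v. uxx z * Re v + uxy z * Im v)) (at z)"
    "\<And>z. z \<in> S \<Longrightarrow> (uy has_derivative (\<lambda>v. uyx z * Re v + uyy z * Im v)) (at z)"
    "continuous_on S uxx" "continuous_on S uxy" "continuous_on S uyx" "continuous_on S uyy"
    "\<And>z. z \<in> S \<Longrightarrow> uxx z + uyy z = 0"
  using assms unfolding harmonic_on_def by blast

lemma harmonic_on_continuous: "harmonic_on u S \<Longrightarrow> continuous_on S u"
  unfolding harmonic_on_def
  by (meson continuous_at_imp_continuous_on has_derivative_continuous)

lemma harmonic_on_cong:
  assumes "harmonic_on u S" and "\<And>z. z \<in> S \<Longrightarrow> u z = v z"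
  shows "harmonic_on v S"
proof -
  have "(v has_derivative D) (at z)" if "(u has_derivative D) (at z)" "z \<in> S" for z D
    using has_derivative_transform_within_open[OF that(1) harmonic_on_open[OF assms(1)] that(2)]
      assms(2) by blast
  with assms(1) show ?thesis
    by (elim harmonic_onE, intro harmonic_onI harmonic_on_open[OF assms(1)]) blast+
qed

lemma harmonic_on_linear_combination:
  assumes "harmonic_on u S" "harmonic_on v S"
  shows "harmonic_on (\<lambda>z. a * u z + b * v z) S"
proof -
  obtain ux uy uxx uxy uyx uyy where u:
    "\<And>z. z \<in> S \<Longrightarrow> (u has_derivative (\<lambda>v. ux z * Re v + uy z * Im v)) (at z)"
    "\<And>z. z \<in> S \<Longrightarrow> (ux has_derivative (\<lambda>v. uxx z * Re v + uxy z * Im v)) (at z)"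
    "\<And>z. z \<in> S \<Longrightarrow> (uy has_derivative (\<lambda>v. uyx z * Re v + uyy z * Im v)) (at z)"
    "continuous_on S uxx" "continuous_on S uxy" "continuous_on S uyx" "continuous_on S uyy"
    "\<And>z. z \<in> S \<Longrightarrow> uxx z + uyy z = 0"
    by (rule harmonic_onE[OF assms(1)]) (rule that)
  obtain vx vy vxx vxy vyx vyy where v:
    "\<And>z. z \<in> S \<Longrightarrow> (v has_derivative (\<lambda>w. vx z * Re w + vy z * Im w)) (at z)"
    "\<And>z. z \<in> S \<Longrightarrow> (vx has_derivative (\<lambda>w. vxx z * Re w + vxy z * Im w)) (at z)"
    "\<And>z. z \<in> S \<Longrightarrow> (vy has_derivative (\<lambda>w. vyx z * Re w + vyy z * Im w)) (at z)"
    "continuous_on S vxx" "continuous_on S vxy" "continuous_on S vyx" "continuous_on S vyy"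
    "\<And>z. z \<in> S \<Longrightarrow> vxx z + vyy z = 0"
    by (rule harmonic_onE[OF assms(2)]) (rule that)
  show ?thesis
  proof (rule harmonic_onI[where ux="\<lambda>z. a * ux z + b * vx z"
      and uy="\<lambda>z. a * uy z + b * vy z"
      and uxx="\<lambda>z. a * uxx z + b * vxx z"
      and uxy="\<lambda>z. a * uxy z + b * vxy z"
      and uyx="\<lambda>z. a * uyx z + b * vyx z"
      and uyy="\<lambda>z. a * uyy z + b * vyy z"])
    fix z assume z: "z \<in> S"
    note [derivative_intros] = u(1-3)[OF z] v(1-3)[OF z]
    show "((\<lambda>z. a * u z + b * v z) has_derivative
        (\<lambda>w. (a * ux z + b * vx z) * Re w + (a * uy z + b * vy z) * Im w)) (at z)"
      by (auto intro!: derivative_eq_intros simp: algebra_simps)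
    show "((\<lambda>z. a * ux z + b * vx z) has_derivative
        (\<lambda>w. (a * uxx z + b * vxx z) * Re w + (a * uxy z + b * vxy z) * Im w)) (at z)"
      by (auto intro!: derivative_eq_intros simp: algebra_simps)
    show "((\<lambda>z. a * uy z + b * vy z) has_derivative
        (\<lambda>w. (a * uyx z + b * vyx z) * Re w + (a * uyy z + b * vyy z) * Im w)) (at z)"
      by (auto intro!: derivative_eq_intros simp: algebra_simps)
    have "a * uxx z + b * vxx z + (a * uyy z + b * vyy z)
        = a * (uxx z + uyy z) + b * (vxx z + vyy z)"
      by (simp add: algebra_simps)
    then show "a * uxx z + b * vxx z + (a * uyy z + b * vyy z) = 0"
      using u(8)[OF z] v(8)[OF z] by simp
  qed (use u(4-7) v(4-7) harmonic_on_open[OF assms(1)] in \<open>auto intro!: continuous_intros\<close>)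
qed

lemma Re_has_derivative:
  assumes "(f has_field_derivative d) (at z)"
  shows "((\<lambda>z. Re (f z)) has_derivative (\<lambda>v. Re d * Re v - Im d * Im v)) (at z)"
  using has_derivative_Re[OF has_field_derivative_imp_has_derivative[OF assms]] by simp

lemma Im_has_derivative:
  assumes "(f has_field_derivative d) (at z)"
  shows "((\<lambda>z. Im (f z)) has_derivative (\<lambda>v. Im d * Re v + Re d * Im v)) (at z)"
  using has_derivative_Im[OF has_field_derivative_imp_has_derivative[OF assms]]
  by (simp add: algebra_simps)

text \<open>The Laplacian of \<open>u \<circ> f\<close> is \<open>\<bar>f'\<bar>\<^sup>2\<close> times that of \<open>u\<close>, since the real and imaginary part
  of \<open>f\<close> are themselves harmonic and the mixed terms cancel by the Cauchy--Riemann equations.\<close>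

lemma harmonic_on_compose_holomorphic:
  assumes u: "harmonic_on u S" and f: "f holomorphic_on T" and T: "open T" and "f ` T \<subseteq> S"
  shows "harmonic_on (\<lambda>z. u (f z)) T"
proof -
  obtain ux uy uxx uxy uyx uyy where u:
    "\<And>z. z \<in> S \<Longrightarrow> (u has_derivative (\<lambda>v. ux z * Re v + uy z * Im v)) (at z)"
    "\<And>z. z \<in> S \<Longrightarrow> (ux has_derivative (\<lambda>v. uxx z * Re v + uxy z * Im v)) (at z)"
    "\<And>z. z \<in> S \<Longrightarrow> (uy has_derivative (\<lambda>v. uyx z * Re v + uyy z * Im v)) (at z)"
    "continuous_on S uxx" "continuous_on S uxy" "continuous_on S uyx" "continuous_on S uyy"
    "\<And>z. z \<in> S \<Longrightarrow> uxx z + uyy z = 0"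
    by (rule harmonic_onE[OF u]) (rule that)
  define a where "a = (\<lambda>z. Re (deriv f z))"
  define b where "b = (\<lambda>z. Im (deriv f z))"
  define a2 where "a2 = (\<lambda>z. Re (deriv (deriv f) z))"
  define b2 where "b2 = (\<lambda>z. Im (deriv (deriv f) z))"
  have f1: "(f has_field_derivative deriv f z) (at z)" if "z \<in> T" for z
    using holomorphic_derivI[OF f T that] .
  have hf': "deriv f holomorphic_on T"
    using holomorphic_deriv[OF f T] .
  have f2: "(deriv f has_field_derivative deriv (deriv f) z) (at z)" if "z \<in> T" for z
    using holomorphic_derivI[OF hf' T that] .
  have D: "((\<lambda>z. w (f z)) has_derivative
       (\<lambda>v. c (f z) * (a z * Re v - b z * Im v) + d (f z) * (b z * Re v + a z * Im v))) (at z)"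
    if "z \<in> T" "\<And>z. z \<in> S \<Longrightarrow> (w has_derivative (\<lambda>v. c z * Re v + d z * Im v)) (at z)"
    for z w c d
  proof -
    have "f z \<in> S" using that assms(4) by auto
    from has_derivative_compose[OF has_field_derivative_imp_has_derivative[OF f1[OF that(1)]]
        that(2)[OF this]]
    show ?thesis by (simp add: a_def b_def algebra_simps)
  qed
  have da: "(a has_derivative (\<lambda>v. a2 z * Re v - b2 z * Im v)) (at z)" if "z \<in> T" for z
    unfolding a_def a2_def b2_def using Re_has_derivative[OF f2[OF that]] .
  have db: "(b has_derivative (\<lambda>v. b2 z * Re v + a2 z * Im v)) (at z)" if "z \<in> T" for z
    unfolding b_def a2_def b2_def using Im_has_derivative[OF f2[OF that]] .
  have cf: "continuous_on T f" "continuous_on T (deriv f)" "continuous_on T (deriv (deriv f))"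
    using f hf' holomorphic_deriv[OF hf' T] by (auto intro: holomorphic_on_imp_continuous_on)
  have cab: "continuous_on T a" "continuous_on T b" "continuous_on T a2" "continuous_on T b2"
    unfolding a_def b_def a2_def b2_def using cf by (auto intro!: continuous_intros)
  have cu: "continuous_on T (\<lambda>z. w (f z))" if "continuous_on S w" for w
    using continuous_on_compose2[OF that cf(1) assms(4)] .
  have cc: "continuous_on S ux" "continuous_on S uy"
    using u(2,3) by (meson continuous_at_imp_continuous_on has_derivative_continuous)+
  show ?thesis
  proof (rule harmonic_onI[where ux="\<lambda>z. ux (f z) * a z + uy (f z) * b z"
      and uy="\<lambda>z. uy (f z) * a z - ux (f z) * b z"
      and uxx="\<lambda>z. (uxx (f z) * a z + uxy (f z) * b z) * a z + ux (f z) * a2 z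
          + (uyx (f z) * a z + uyy (f z) * b z) * b z + uy (f z) * b2 z"
      and uxy="\<lambda>z. (uxy (f z) * a z - uxx (f z) * b z) * a z - ux (f z) * b2 z
          + (uyy (f z) * a z - uyx (f z) * b z) * b z + uy (f z) * a2 z"
      and uyx="\<lambda>z. (uyx (f z) * a z + uyy (f z) * b z) * a z + uy (f z) * a2 z
          - (uxx (f z) * a z + uxy (f z) * b z) * b z - ux (f z) * b2 z"
      and uyy="\<lambda>z. (uyy (f z) * a z - uyx (f z) * b z) * a z - uy (f z) * b2 z
          - (uxy (f z) * a z - uxx (f z) * b z) * b z - ux (f z) * a2 z"])
    fix z assume z: "z \<in> T"
    note D1 = D[OF z u(1)] and D2 = D[OF z u(2)] and D3 = D[OF z u(3)]
    show "((\<lambda>z. u (f z)) has_derivative (\<lambda>v. (ux (f z) * a z + uy (f z) * b z) * Re v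
        + (uy (f z) * a z - ux (f z) * b z) * Im v)) (at z)"
      by (rule has_derivative_eq_rhs[OF D1]) (auto simp: algebra_simps)
    show "((\<lambda>z. ux (f z) * a z + uy (f z) * b z) has_derivative
      (\<lambda>v. ((uxx (f z) * a z + uxy (f z) * b z) * a z + ux (f z) * a2 z
          + (uyx (f z) * a z + uyy (f z) * b z) * b z + uy (f z) * b2 z) * Re v +
        ((uxy (f z) * a z - uxx (f z) * b z) * a z - ux (f z) * b2 z
          + (uyy (f z) * a z - uyx (f z) * b z) * b z + uy (f z) * a2 z) * Im v)) (at z)"
      by (rule has_derivative_eq_rhs[OF has_derivative_add
            [OF has_derivative_mult[OF D2 da[OF z]] has_derivative_mult[OF D3 db[OF z]]]])
        (auto simp: algebra_simps)
    show "((\<lambda>z. uy (f z) * a z - ux (f z) * b z) has_derivative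
      (\<lambda>v. ((uyx (f z) * a z + uyy (f z) * b z) * a z + uy (f z) * a2 z
          - (uxx (f z) * a z + uxy (f z) * b z) * b z - ux (f z) * b2 z) * Re v +
        ((uyy (f z) * a z - uyx (f z) * b z) * a z - uy (f z) * b2 z
          - (uxy (f z) * a z - uxx (f z) * b z) * b z - ux (f z) * a2 z) * Im v)) (at z)"
      by (rule has_derivative_eq_rhs[OF has_derivative_diff
            [OF has_derivative_mult[OF D3 da[OF z]] has_derivative_mult[OF D2 db[OF z]]]])
        (auto simp: algebra_simps)
    have "uyy (f z) = - uxx (f z)" using u(8)[of "f z"] z assms(4) by force
    then show "(uxx (f z) * a z + uxy (f z) * b z) * a z + ux (f z) * a2 z
          + (uyx (f z) * a z + uyy (f z) * b z) * b z + uy (f z) * b2 z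
      + ((uyy (f z) * a z - uyx (f z) * b z) * a z - uy (f z) * b2 z
          - (uxy (f z) * a z - uxx (f z) * b z) * b z - ux (f z) * a2 z) = 0"
      by (simp add: algebra_simps)
  qed (use T cab cu[OF u(4)] cu[OF u(5)] cu[OF u(6)] cu[OF u(7)] cu[OF cc(1)] cu[OF cc(2)] in
      \<open>auto intro!: continuous_intros\<close>)
qed

text \<open>Here \<open>f\<close> is \<open>2 \<partial>u/\<partial>z\<close>, so \<open>u\<close> is harmonic as soon as it has a holomorphic complex gradient.\<close>

lemma harmonic_on_if_gradient_holomorphic:
  assumes S: "open S" and f: "f holomorphic_on S"
    and u: "\<And>z. z \<in> S \<Longrightarrow> (u has_derivative (\<lambda>v. Re (f z * v))) (at z)"
  shows "harmonic_on u S"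
proof -
  have f1: "(f has_field_derivative deriv f z) (at z)" if "z \<in> S" for z
    using holomorphic_derivI[OF f S that] .
  have c: "continuous_on S (deriv f)"
    using holomorphic_deriv[OF f S] by (rule holomorphic_on_imp_continuous_on)
  show ?thesis
  proof (rule harmonic_onI[where ux="\<lambda>z. Re (f z)"
      and uy="\<lambda>z. - Im (f z)"
      and uxx="\<lambda>z. Re (deriv f z)"
      and uxy="\<lambda>z. - Im (deriv f z)"
      and uyx="\<lambda>z. - Im (deriv f z)"
      and uyy="\<lambda>z. - Re (deriv f z)"])
    fix z assume z: "z \<in> S"
    show "(u has_derivative (\<lambda>v. Re (f z) * Re v + - Im (f z) * Im v)) (at z)"
      using u[OF z] by simp
    show "((\<lambda>z. Re (f z)) has_derivative
        (\<lambda>v. Re (deriv f z) * Re v + - Im (deriv f z) * Im v)) (at z)"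
      using Re_has_derivative[OF f1[OF z]] by simp
    show "((\<lambda>z. - Im (f z)) has_derivative
        (\<lambda>v. - Im (deriv f z) * Re v + - Re (deriv f z) * Im v)) (at z)"
      using has_derivative_minus[OF Im_has_derivative[OF f1[OF z]]] by (simp add: algebra_simps)
  qed (use c S in \<open>auto intro!: continuous_intros\<close>)
qed

lemma ln_norm_has_derivative:
  fixes \<Phi> :: "complex \<Rightarrow> complex"
  assumes "(\<Phi> has_field_derivative d) (at z)" "\<Phi> z \<noteq> 0"
  shows "((\<lambda>z. ln (norm (\<Phi> z))) has_derivative (\<lambda>v. Re (d / \<Phi> z * v))) (at z)"
proof -
  have n: "((\<lambda>z. norm (\<Phi> z)) has_derivative (\<lambda>v. \<Phi> z \<bullet> (d * v) / norm (\<Phi> z))) (at z)"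
    using has_derivative_compose[OF has_field_derivative_imp_has_derivative[OF assms(1)]
        has_derivative_norm[OF assms(2)]]
    by (simp add: sgn_div_norm inner_commute divide_simps)
  have "((\<lambda>z. ln (norm (\<Phi> z))) has_derivative
      (\<lambda>v. \<Phi> z \<bullet> (d * v) / norm (\<Phi> z) / norm (\<Phi> z))) (at z)"
    using has_derivative_ln[OF _ n] assms(2) by (simp add: divide_simps)
  moreover have "\<Phi> z \<bullet> (d * v) / norm (\<Phi> z) / norm (\<Phi> z) = Re (d / \<Phi> z * v)" for v
  proof -
    have "Re (d / \<Phi> z * v) = Re (d * v * cnj (\<Phi> z) / (norm (\<Phi> z))\<^sup>2)"
      by (subst times_divide_eq_left, subst complex_div_cnj) simp
    also have "\<dots> = Re (d * v * cnj (\<Phi> z)) / (norm (\<Phi> z))\<^sup>2"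
      by (metis Re_divide_of_real of_real_power)
    also have "Re (d * v * cnj (\<Phi> z)) = \<Phi> z \<bullet> (d * v)"
      by (simp add: inner_complex_def algebra_simps)
    finally show ?thesis by (simp add: power2_eq_square)
  qed
  ultimately show ?thesis by simp
qed

text \<open>The local representations may use unrelated functions \<open>\<Phi>\<close>: their logarithmic derivatives agree
  on overlaps because they are determined by the derivative of \<open>u\<close>.\<close>

lemma harmonic_on_if_locally_ln_norm:
  assumes S: "open S"
    and loc: "\<And>z. z \<in> S \<Longrightarrow> \<exists>e>0. \<exists>\<Phi>. ball z e \<subseteq> S \<and> \<Phi> holomorphic_on ball z e \<and>
        (\<forall>w\<in>ball z e. \<Phi> w \<noteq> 0 \<and> u w = ln (norm (\<Phi> w)))"
  shows "harmonic_on u S"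
proof -
  define f where "f = (\<lambda>z. THE c. (u has_derivative (\<lambda>v. Re (c * v))) (at z))"
  have uniq: "c = c'" if "(u has_derivative (\<lambda>v. Re (c * v))) (at z)"
    "(u has_derivative (\<lambda>v. Re (c' * v))) (at z)" for c c' z
  proof -
    have "(\<lambda>v. Re (c * v)) = (\<lambda>v. Re (c' * v))"
      using has_derivative_unique[OF that] .
    from fun_cong[OF this, of 1] fun_cong[OF this, of \<i>] show ?thesis
      by (simp add: complex_eq_iff)
  qed
  have f_eq: "f z = c" if "(u has_derivative (\<lambda>v. Re (c * v))) (at z)" for c z
    unfolding f_def using that uniq by blast
  have *: "\<exists>e>0. ball z e \<subseteq> S \<and> f holomorphic_on ball z e \<and>
      (\<forall>w\<in>ball z e. (u has_derivative (\<lambda>v. Re (f w * v))) (at w))" if "z \<in> S" for z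
  proof -
    from loc[OF that] obtain e \<Phi> where e: "e > 0" "ball z e \<subseteq> S" "\<Phi> holomorphic_on ball z e"
      "\<And>w. w \<in> ball z e \<Longrightarrow> \<Phi> w \<noteq> 0 \<and> u w = ln (norm (\<Phi> w))" by blast
    have d: "(u has_derivative (\<lambda>v. Re (deriv \<Phi> w / \<Phi> w * v))) (at w)" if "w \<in> ball z e" for w
    proof -
      have "((\<lambda>z. ln (norm (\<Phi> z))) has_derivative (\<lambda>v. Re (deriv \<Phi> w / \<Phi> w * v))) (at w)"
        using ln_norm_has_derivative holomorphic_derivI[OF e(3) _ that] e(4)[OF that] by blast
      then show ?thesis
        by (rule has_derivative_transform_within_open[OF _ open_ball that]) (use e(4) in auto)
    qed
    have "(\<lambda>w. deriv \<Phi> w / \<Phi> w) holomorphic_on ball z e"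
      using e(3,4) by (auto intro!: holomorphic_intros)
    then have "f holomorphic_on ball z e"
      by (rule holomorphic_transform) (simp only: f_eq[OF d])
    moreover have "\<forall>w\<in>ball z e. (u has_derivative (\<lambda>v. Re (f w * v))) (at w)"
      using d f_eq[OF d] by presburger
    ultimately show ?thesis using e by blast
  qed
  have "f holomorphic_on S"
    by (meson * S centre_in_ball field_differentiable_at_within holomorphic_on_def
        holomorphic_on_imp_differentiable_at open_ball)
  moreover have "(u has_derivative (\<lambda>v. Re (f z * v))) (at z)" if "z \<in> S" for z
    using *[OF that] by auto
  ultimately show ?thesis using harmonic_on_if_gradient_holomorphic[OF S] by blast
qed

subsection \<open>The maximum principle\<close>

lemma no_local_max_if_second_derivative_pos:
  fixes \<phi> :: "real \<Rightarrow> real"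
  assumes "e > 0" and \<phi>: "\<And>t. \<bar>t\<bar> < e \<Longrightarrow> (\<phi> has_real_derivative \<phi>' t) (at t)"
    and "(\<phi>' has_real_derivative l) (at 0)" "l > 0"
    and max: "\<And>t. \<bar>t\<bar> < e \<Longrightarrow> \<phi> t \<le> \<phi> 0"
  shows False
proof -
  have "\<phi>' 0 = 0"
    by (rule DERIV_local_max[OF \<phi> \<open>e > 0\<close>]) (use assms in auto)
  with DERIV_pos_inc_right[OF assms(3,4)] obtain d where
    d: "d > 0" "\<And>h. h > 0 \<Longrightarrow> h < d \<Longrightarrow> 0 < \<phi>' h" by auto
  define t where "t = min d e / 2"
  have t: "0 < t" "t < d" "t < e" using d \<open>e > 0\<close> by (auto simp: t_def min_def)
  have "\<phi> 0 < \<phi> t"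
  proof (rule DERIV_pos_imp_increasing_open[OF t(1)])
    show "\<exists>y. (\<phi> has_real_derivative y) (at x) \<and> 0 < y" if "0 < x" "x < t" for x
      using \<phi>[of x] d(2)[of x] that t by force
    show "continuous_on {0..t} \<phi>"
      using \<phi> t by (force intro!: continuous_at_imp_continuous_on DERIV_isCont)
  qed
  with max[of t] t show False by auto
qed

text \<open>Adding a small multiple of \<open>\<bar>z\<bar>\<^sup>2\<close> makes the Laplacian positive, and then one of the pure second
  derivatives is positive at a maximum. The compactness hypothesis says that \<open>u\<close> does not exceed \<open>M\<close>
  in the limit at the boundary and, for unbounded \<open>S\<close>, at infinity.\<close>

lemma harmonic_on_maximum_principle:
  assumes u: "harmonic_on u S"
    and cpt: "\<And>\<epsilon>. \<epsilon> > 0 \<Longrightarrow> compact {z\<in>S. u z \<ge> M + \<epsilon>}"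
    and "w \<in> S"
  shows "u w \<le> M"
proof (rule ccontr)
  assume "\<not> u w \<le> M"
  define \<epsilon> where "\<epsilon> = (u w - M) / 2"
  have eps: "\<epsilon> > 0" "u w = M + 2 * \<epsilon>" using \<open>\<not> u w \<le> M\<close> by (auto simp: \<epsilon>_def field_simps)
  have S: "open S" using u by (rule harmonic_on_open)
  define K where "K = {z\<in>S. u z \<ge> M + \<epsilon>}"
  have K: "compact K" "w \<in> K" using cpt[OF eps(1)] \<open>w \<in> S\<close> eps by (auto simp: K_def)
  from compact_imp_bounded[OF K(1)] obtain B where B: "B > 0" "\<And>z. z \<in> K \<Longrightarrow> norm z \<le> B"
    using bounded_pos by blast
  define \<delta> where "\<delta> = \<epsilon> / (2 * B\<^sup>2)"
  have \<delta>: "\<delta> > 0" "\<delta> * B\<^sup>2 < \<epsilon>" using B eps by (auto simp: \<delta>_def)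
  define v where "v = (\<lambda>z. u z + \<delta> * ((Re z)\<^sup>2 + (Im z)\<^sup>2))"
  have cu: "continuous_on S u" using harmonic_on_continuous[OF u] .
  have "continuous_on K v" unfolding v_def
    using continuous_on_subset[OF cu, of K] by (auto intro!: continuous_intros simp: K_def)
  with K obtain z1 where z1: "z1 \<in> K" "\<And>z. z \<in> K \<Longrightarrow> v z \<le> v z1"
    using continuous_attains_sup[of K v] by auto
  have "M + 2 * \<epsilon> \<le> v w" using eps \<delta> by (simp add: v_def)
  also have "\<dots> \<le> v z1" using z1 K by blast
  also have "\<dots> = u z1 + \<delta> * (norm z1)\<^sup>2" by (simp add: v_def cmod_power2)
  also have "\<dots> \<le> u z1 + \<delta> * B\<^sup>2" using \<delta> B(2)[OF z1(1)] by (simp add: power_mono)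
  finally have "u z1 > M + \<epsilon>" using \<delta> by simp
  define U where "U = {z\<in>S. u z > M + \<epsilon>}"
  have "open U" unfolding U_def
    using continuous_open_preimage[OF cu S, of "{M + \<epsilon><..}"]
    by (simp add: vimage_def Int_def)
  moreover have "z1 \<in> U" using z1 \<open>u z1 > M + \<epsilon>\<close> by (simp add: U_def K_def)
  ultimately obtain e where e: "e > 0" "ball z1 e \<subseteq> U"
    using open_contains_ball by blast
  have max: "v z \<le> v z1" if "z \<in> ball z1 e" for z
    using that e z1(2)[of z] by (auto simp: U_def K_def)
  have inS: "z \<in> S" if "z \<in> ball z1 e" for z using that e by (auto simp: U_def)
  obtain ux uy uxx uxy uyx uyy where u:
    "\<And>z. z \<in> S \<Longrightarrow> (u has_derivative (\<lambda>v. ux z * Re v + uy z * Im v)) (at z)"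
    "\<And>z. z \<in> S \<Longrightarrow> (ux has_derivative (\<lambda>v. uxx z * Re v + uxy z * Im v)) (at z)"
    "\<And>z. z \<in> S \<Longrightarrow> (uy has_derivative (\<lambda>v. uyx z * Re v + uyy z * Im v)) (at z)"
    "\<And>z. z \<in> S \<Longrightarrow> uxx z + uyy z = 0"
    by (rule harmonic_onE[OF u]) (rule that)
  have z1S: "z1 \<in> S" using inS e by simp
  have line: "((\<lambda>t. f (z1 + of_real t * c)) has_real_derivative (p * Re c + q * Im c)) (at t)"
    if "(f has_derivative (\<lambda>v. p * Re v + q * Im v)) (at (z1 + of_real t * c))"
    for f p q c and t :: real
  proof -
    have "((\<lambda>t. z1 + of_real t * c) has_derivative (\<lambda>s. of_real s * c)) (at t)"
      by (auto intro!: derivative_eq_intros)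
    from has_derivative_compose[OF this that] show ?thesis
      unfolding has_field_derivative_def
      by (rule has_derivative_eq_rhs) (auto simp: algebra_simps)
  qed
  have ball: "z1 + of_real t * c \<in> ball z1 e" if "\<bar>t\<bar> < e" "norm c = 1" for t :: real and c
    using that by (simp add: dist_norm norm_mult)
  have sq: "((\<lambda>t. \<delta> * ((Re (z1 + of_real t * c))\<^sup>2 + (Im (z1 + of_real t * c))\<^sup>2)) has_real_derivative
      2 * \<delta> * (Re (z1 + of_real t * c) * Re c + Im (z1 + of_real t * c) * Im c)) (at t)" for t c
    by (auto intro!: derivative_eq_intros simp: algebra_simps)
  have "uxx z1 + 2 * \<delta> \<le> 0"
  proof (rule ccontr)
    assume pos: "\<not> ?thesis"
    show False
    proof (rule no_local_max_if_second_derivative_pos[where e=e and \<phi>="\<lambda>t. v (z1 + of_real t * 1)"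
          and \<phi>'="\<lambda>t. ux (z1 + of_real t * 1) + 2 * \<delta> * Re (z1 + of_real t * 1)"
          and l="uxx z1 + 2 * \<delta>"])
      fix t :: real assume t: "\<bar>t\<bar> < e"
      show "v (z1 + of_real t * 1) \<le> v (z1 + of_real 0 * 1)"
        using max[OF ball[OF t, of 1]] by (simp del: mem_ball)
      show "((\<lambda>t. v (z1 + of_real t * 1)) has_real_derivative
          (ux (z1 + of_real t * 1) + 2 * \<delta> * Re (z1 + of_real t * 1))) (at t)"
        using DERIV_add[OF line[of u _ _ t 1, OF u(1)[OF inS[OF ball[OF t]]]] sq[of 1 t]]
        by (simp add: v_def)
    next
      show "((\<lambda>t. ux (z1 + of_real t * 1) + 2 * \<delta> * Re (z1 + of_real t * 1))
          has_real_derivative uxx z1 + 2 * \<delta>) (at 0)"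
        using line[of ux _ _ 0 1] u(2)[OF z1S]
        by (auto intro!: derivative_eq_intros)
    qed (use e pos in auto)
  qed
  moreover have "uyy z1 + 2 * \<delta> \<le> 0"
  proof (rule ccontr)
    assume pos: "\<not> ?thesis"
    show False
    proof (rule no_local_max_if_second_derivative_pos[where e=e and \<phi>="\<lambda>t. v (z1 + of_real t * \<i>)"
          and \<phi>'="\<lambda>t. uy (z1 + of_real t * \<i>) + 2 * \<delta> * Im (z1 + of_real t * \<i>)"
          and l="uyy z1 + 2 * \<delta>"])
      fix t :: real assume t: "\<bar>t\<bar> < e"
      show "v (z1 + of_real t * \<i>) \<le> v (z1 + of_real 0 * \<i>)"
        using max[OF ball[OF t, of \<i>]] by (simp del: mem_ball)
      show "((\<lambda>t. v (z1 + of_real t * \<i>)) has_real_derivative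
          (uy (z1 + of_real t * \<i>) + 2 * \<delta> * Im (z1 + of_real t * \<i>))) (at t)"
        using DERIV_add[OF line[of u _ _ t \<i>, OF u(1)[OF inS[OF ball[OF t]]]] sq[of \<i> t]]
        by (simp add: v_def)
    next
      show "((\<lambda>t. uy (z1 + of_real t * \<i>) + 2 * \<delta> * Im (z1 + of_real t * \<i>))
          has_real_derivative uyy z1 + 2 * \<delta>) (at 0)"
        using line[of uy _ _ 0 \<i>] u(3)[OF z1S]
        by (auto intro!: derivative_eq_intros)
    qed (use e pos in auto)
  qed
  ultimately show False using u(4)[OF z1S] \<delta> by simp
qed

section \<open>Polynomial convexity and Green functions\<close>

lemma polynomially_convex_imp_compact: "polynomially_convex K \<Longrightarrow> compact K"
  unfolding polynomially_convex_def by blast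

lemma polynomially_convex_separation:
  assumes "polynomially_convex K" "z \<notin> K"
  obtains q where "norm (poly q z) > (SUP w\<in>K. norm (poly q w))"
proof -
  have "K = polynomial_hull K" using assms(1) unfolding polynomially_convex_def by (rule conjunct2)
  then have "z \<notin> polynomial_hull K" using assms(2) by (rule subst)
  then show ?thesis using that by (auto simp: polynomial_hull_def not_le)
qed

lemma compact_imp_subset_polynomial_hull:
  assumes "compact K"
  shows "K \<subseteq> polynomial_hull K"
proof
  fix z assume "z \<in> K"
  have "bdd_above ((\<lambda>w. norm (poly q w)) ` K)" for q
    by (intro bounded_imp_bdd_above compact_imp_bounded compact_continuous_image)
      (auto intro!: continuous_intros assms)
  then show "z \<in> polynomial_hull K"
    unfolding polynomial_hull_def using \<open>z \<in> K\<close> by (auto intro: cSUP_upper2)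
qed

lemma polynomially_convexI:
  assumes "compact K" "K \<noteq> {}"
    and sep: "\<And>z. z \<notin> K \<Longrightarrow> \<exists>q B. (\<forall>w\<in>K. norm (poly q w) \<le> B) \<and> B < norm (poly q z)"
  shows "polynomially_convex K"
proof -
  have "z \<in> K" if z: "z \<in> polynomial_hull K" for z
  proof (rule ccontr)
    assume "z \<notin> K"
    from sep[OF this] obtain q B where q: "\<And>w. w \<in> K \<Longrightarrow> norm (poly q w) \<le> B"
      "B < norm (poly q z)" by blast
    have "norm (poly q z) \<le> (SUP w\<in>K. norm (poly q w))"
      using z by (simp add: polynomial_hull_def)
    also have "\<dots> \<le> B" using q(1) assms(2) by (intro cSUP_least)
    finally show False using q(2) by simp
  qed
  with compact_imp_subset_polynomial_hull[OF assms(1)] assms(1) show ?thesis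
    unfolding polynomially_convex_def by blast
qed

text \<open>By the maximum modulus principle the bounded components of the complement belong to the
  polynomial hull.\<close>

lemma polynomially_convex_outside:
  assumes "polynomially_convex K"
  shows "outside K = - K"
proof -
  have K: "compact K" using assms by (rule polynomially_convex_imp_compact)
  have "x \<notin> inside K" for x
  proof
    assume x: "x \<in> inside K"
    define C where "C = connected_component_set (- K) x"
    have "x \<notin> K" "bounded C" using x by (auto simp: inside_def C_def)
    have C: "C \<in> components (- K)" using \<open>x \<notin> K\<close> by (auto simp: C_def components_def)
    have fr: "frontier C \<subseteq> K"
      using frontier_of_components_closed_complement[OF compact_imp_closed[OF K] C] .
    have "norm (poly q x) \<le> (SUP w\<in>K. norm (poly q w))" for q
    proof (rule maximum_modulus_frontier[where S=C and f="poly q" and \<xi>=x])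
      have "bdd_above ((\<lambda>w. norm (poly q w)) ` K)"
        by (intro bounded_imp_bdd_above compact_imp_bounded compact_continuous_image)
          (auto intro!: continuous_intros K)
      then show "norm (poly q z) \<le> (SUP w\<in>K. norm (poly q w))" if "z \<in> frontier C" for z
        using that fr by (auto intro: cSUP_upper2)
      show "x \<in> C" using \<open>x \<notin> K\<close> by (simp add: C_def)
    qed (use \<open>bounded C\<close> in \<open>auto intro!: holomorphic_intros continuous_intros\<close>)
    with polynomially_convex_separation[OF assms \<open>x \<notin> K\<close>] show False by (metis not_le)
  qed
  then have "inside K = {}" by blast
  then show ?thesis using inside_Un_outside[of K] by simp
qed

text \<open>The Green function of the complement of \<open>E\<close>, extended by 0. With the extension the boundary
  behaviour becomes continuity on the whole plane, which is preserved by composition with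
  polynomials and by uniform limits.\<close>

definition extended_green :: "complex set \<Rightarrow> (complex \<Rightarrow> real) \<Rightarrow> bool" where
  "extended_green E G \<longleftrightarrow> continuous_on UNIV G \<and> (\<forall>z\<in>E. G z = 0) \<and> (\<forall>z\<in>-E. G z > 0) \<and>
     harmonic_on G (- E) \<and> (\<exists>c. ((\<lambda>z. G z - ln (norm z)) \<longlongrightarrow> c) at_infinity)"

lemma at_infinity_inf_principal_compl:
  fixes E :: "'a::real_normed_vector set"
  assumes "bounded E"
  shows "inf at_infinity (principal (- E)) = at_infinity"
proof (rule inf_absorb1)
  from assms obtain B where "\<And>z. z \<in> E \<Longrightarrow> norm z \<le> B" using bounded_iff by blast
  then have "eventually (\<lambda>z. z \<in> - E) at_infinity"
    unfolding eventually_at_infinity by (intro exI[of _ "B + 1"]) force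
  then show "at_infinity \<le> principal (- E)" by (simp add: le_principal)
qed

lemma extended_green_imp_is_green_function:
  assumes "compact E" "extended_green E G"
  shows "is_green_function (- E) G"
proof -
  have "(G \<longlongrightarrow> 0) (at w within - E)" if "w \<in> frontier (- E)" for w
  proof -
    have "w \<in> E" using that compact_imp_closed[OF assms(1)] frontier_subset_closed
      by (auto simp: frontier_complement)
    with assms(2) have "isCont G w" "G w = 0"
      by (auto simp: extended_green_def continuous_on_eq_continuous_at)
    then show ?thesis
      by (metis continuous_within isCont_def tendsto_within_subset top_greatest)
  qed
  with assms show ?thesis
    unfolding is_green_function_def extended_green_def
    by (auto simp: at_infinity_inf_principal_compl compact_imp_bounded)
qed

lemma is_green_function_imp_extended_green:
  assumes "compact E" "is_green_function (- E) g"
  shows "extended_green E (\<lambda>z. if z \<in> E then 0 else g z)"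
proof -
  define G where "G = (\<lambda>z. if z \<in> E then 0 else g z)"
  have g: "harmonic_on g (- E)" "\<And>z. z \<in> - E \<Longrightarrow> g z > 0"
    "\<And>w. w \<in> frontier (- E) \<Longrightarrow> (g \<longlongrightarrow> 0) (at w within - E)"
    using assms by (auto simp: is_green_function_def)
  from assms obtain c where c: "((\<lambda>z. g z - ln (norm z)) \<longlongrightarrow> c) at_infinity"
    by (auto simp: is_green_function_def at_infinity_inf_principal_compl compact_imp_bounded)
  have op: "open (- E)" using assms(1) by (simp add: compact_imp_closed open_Compl)
  have harm: "harmonic_on G (- E)" by (rule harmonic_on_cong[OF g(1)]) (auto simp: G_def)
  have "isCont G w" for w
  proof (cases "w \<in> E")
    case False
    then show ?thesis
      using harmonic_on_continuous[OF harm] op by (auto simp: continuous_on_eq_continuous_at)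
  next
    case True
    have "(G \<longlongrightarrow> 0) (at w within - E)"
    proof (cases "w \<in> frontier (- E)")
      case True
      show ?thesis
        using g(3)[OF True]
        by (rule Lim_transform_within[where d=1]) (simp_all add: G_def)
    next
      case False
      then have "w \<in> interior E" using True interior_subset[of "- E"]
        by (auto simp: frontier_def closure_complement)
      then have "w \<notin> closure (- E - {w})" using True by (simp add: closure_complement)
      then have "at w within - E = bot" by (simp add: at_within_eq_bot_iff)
      then show ?thesis by simp
    qed
    moreover have "(G \<longlongrightarrow> 0) (at w within E)"
      by (rule Lim_transform_within[OF tendsto_const zero_less_one]) (simp add: G_def)
    ultimately have "(G \<longlongrightarrow> 0) (at w)"
      using Lim_Un[of G 0 w "- E" E] by (simp add: Compl_partition2)
    then show ?thesis using True by (simp add: isCont_def G_def)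
  qed
  moreover have "((\<lambda>z. G z - ln (norm z)) \<longlongrightarrow> c) at_infinity"
  proof (rule Lim_transform_eventually[OF c])
    have "eventually (\<lambda>z. z \<in> - E) at_infinity"
      using at_infinity_inf_principal_compl[OF compact_imp_bounded[OF assms(1)]]
      by (metis inf.cobounded2 le_principal)
    then show "\<forall>\<^sub>F z in at_infinity. g z - ln (norm z) = G z - ln (norm z)"
      by eventually_elim (auto simp: G_def)
  qed
  ultimately show ?thesis
    using g(2) harm unfolding extended_green_def G_def[symmetric]
    by (auto simp: continuous_on_eq_continuous_at G_def)
qed

lemma bounded_Collect_if_eventually_not:
  fixes P :: "'a::real_normed_vector \<Rightarrow> bool"
  assumes "eventually (\<lambda>z. \<not> P z) at_infinity"
  shows "bounded {z. P z}"
proof -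
  from assms obtain b where "\<And>z. P z \<Longrightarrow> \<not> b \<le> norm z"
    unfolding eventually_at_infinity by blast
  then show ?thesis unfolding bounded_iff by (intro exI[of _ b]) (simp add: less_imp_le not_le)
qed

lemma ln_norm_at_top: "filterlim (\<lambda>z::complex. ln (norm z)) at_top at_infinity"
  by (rule filterlim_compose[OF ln_at_top filterlim_norm_at_top])

lemma extended_green_at_top:
  assumes "extended_green E G"
  shows "filterlim G at_top at_infinity"
proof -
  from assms obtain c where "((\<lambda>z. G z - ln (norm z)) \<longlongrightarrow> c) at_infinity"
    by (auto simp: extended_green_def)
  from filterlim_tendsto_add_at_top[OF this ln_norm_at_top] show ?thesis by simp
qed

text \<open>A Green function of the whole plane would be harmonic and tend to infinity at infinity, so it
  would lie above every constant.\<close>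

lemma extended_green_nonempty:
  assumes "extended_green E G"
  shows "E \<noteq> {}"
proof
  assume "E = {}"
  have G: "continuous_on UNIV G" "harmonic_on G UNIV"
    using assms \<open>E = {}\<close> by (auto simp: extended_green_def)
  have "harmonic_on (\<lambda>z. (- 1) * G z + 0 * G z) UNIV"
    by (rule harmonic_on_linear_combination[OF G(2) G(2)])
  then have harm: "harmonic_on (\<lambda>z. - G z) UNIV" by simp
  have "- G 0 \<le> - G 0 - 1"
  proof (rule harmonic_on_maximum_principle[OF harm])
    fix \<epsilon> :: real assume "\<epsilon> > 0"
    define M where "M = - G 0 - 1 + \<epsilon>"
    have "closed {z. - G z \<ge> M}"
      using G(1) by (intro closed_Collect_le continuous_intros)
    moreover have "bounded {z. - G z \<ge> M}"
    proof -
      have "eventually (\<lambda>z. G z > - M) at_infinity"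
        using extended_green_at_top[OF assms] by (simp add: filterlim_at_top_dense)
      then have "eventually (\<lambda>z. \<not> M \<le> - G z) at_infinity"
        by eventually_elim simp
      then show ?thesis by (rule bounded_Collect_if_eventually_not)
    qed
    ultimately show "compact {z \<in> UNIV. - G 0 - 1 + \<epsilon> \<le> - G z}"
      by (simp add: compact_eq_bounded_closed M_def)
  qed auto
  then show False by simp
qed

text \<open>The difference of two Green functions tends to a finite number at infinity that is not known in
  advance; \<open>(1 - \<epsilon>) G\<^sub>1 - G\<^sub>2\<close> tends to \<open>-\<infinity>\<close> instead, and the maximum principle applies.\<close>

lemma extended_green_le:
  assumes "extended_green E G1" "extended_green E G2"
  shows "G1 z \<le> G2 z"
proof -
  have G1: "continuous_on UNIV G1" "harmonic_on G1 (- E)"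
    and G2: "continuous_on UNIV G2" "harmonic_on G2 (- E)"
    using assms by (auto simp: extended_green_def)
  have *: "(1 - \<epsilon>) * G1 z - G2 z \<le> 0" if "\<epsilon> > 0" "z \<in> - E" for \<epsilon>
  proof (rule harmonic_on_maximum_principle[where S="- E" and w=z])
    show "harmonic_on (\<lambda>z. (1 - \<epsilon>) * G1 z - G2 z) (- E)"
      using harmonic_on_linear_combination[OF G1(2) G2(2), of "1 - \<epsilon>" "- 1"] by simp
    fix \<delta> :: real assume "\<delta> > 0"
    have eq: "{z \<in> - E. 0 + \<delta> \<le> (1 - \<epsilon>) * G1 z - G2 z} = {z. \<delta> \<le> (1 - \<epsilon>) * G1 z - G2 z}"
      using assms \<open>\<delta> > 0\<close> by (auto simp: extended_green_def)
    have "closed {z. \<delta> \<le> (1 - \<epsilon>) * G1 z - G2 z}"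
      using G1(1) G2(1) by (intro closed_Collect_le continuous_intros)
    moreover have "bounded {z. \<delta> \<le> (1 - \<epsilon>) * G1 z - G2 z}"
    proof -
      from assms obtain c1 c2 where c: "((\<lambda>z. G1 z - ln (norm z)) \<longlongrightarrow> c1) at_infinity"
        "((\<lambda>z. G2 z - ln (norm z)) \<longlongrightarrow> c2) at_infinity"
        by (auto simp: extended_green_def)
      have "((\<lambda>z. - ((G1 z - ln (norm z)) - (G2 z - ln (norm z)))) \<longlongrightarrow> - (c1 - c2)) at_infinity"
        by (intro tendsto_intros c)
      moreover have "filterlim (\<lambda>z. \<epsilon> * G1 z) at_top at_infinity"
        using filterlim_tendsto_pos_mult_at_top[OF tendsto_const \<open>\<epsilon> > 0\<close> extended_green_at_top[OF assms(1)]] .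
      ultimately have "filterlim (\<lambda>z. - ((G1 z - ln (norm z)) - (G2 z - ln (norm z))) + \<epsilon> * G1 z)
          at_top at_infinity"
        by (rule filterlim_tendsto_add_at_top)
      moreover have "(\<lambda>z. - ((G1 z - ln (norm z)) - (G2 z - ln (norm z))) + \<epsilon> * G1 z)
          = (\<lambda>z. - ((1 - \<epsilon>) * G1 z - G2 z))"
        by (auto simp: algebra_simps)
      ultimately have "eventually (\<lambda>z. - ((1 - \<epsilon>) * G1 z - G2 z) > - \<delta>) at_infinity"
        by (simp only: filterlim_at_top_dense)
      then have "eventually (\<lambda>z. \<not> \<delta> \<le> (1 - \<epsilon>) * G1 z - G2 z) at_infinity"
        by eventually_elim simp
      then show ?thesis by (rule bounded_Collect_if_eventually_not)
    qed
    ultimately show "compact {z \<in> - E. 0 + \<delta> \<le> (1 - \<epsilon>) * G1 z - G2 z}"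
      unfolding eq by (simp add: compact_eq_bounded_closed)
  qed (use that in auto)
  show ?thesis
  proof (cases "z \<in> E")
    case True
    with assms show ?thesis by (simp add: extended_green_def)
  next
    case False
    have "((\<lambda>\<epsilon>. (1 - \<epsilon>) * G1 z - G2 z) \<longlongrightarrow> (1 - 0) * G1 z - G2 z) (at_right 0)"
      by (intro tendsto_intros)
    then have "(1 - 0) * G1 z - G2 z \<le> 0"
      by (rule tendsto_upperbound) (use * False in \<open>auto simp: eventually_at_filter\<close>)
    then show ?thesis by simp
  qed
qed

lemma extended_green_unique:
  assumes "extended_green E G1" "extended_green E G2"
  shows "G1 = G2"
  using extended_green_le[OF assms] extended_green_le[OF assms(2,1)] by (intro ext antisym)

lemma extended_green_green:
  assumes "polynomially_convex E" "regular_compact E"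
  shows "extended_green E (green E)"
proof -
  have out: "outside E = - E" using polynomially_convex_outside[OF assms(1)] .
  have "is_green_function (- E) (SOME g. is_green_function (outside E) g)"
    using assms(2) unfolding regular_compact_def out by (metis someI_ex)
  from is_green_function_imp_extended_green[OF _ this] assms(2)
  have "extended_green E (\<lambda>z. if z \<in> E then 0 else (SOME g. is_green_function (outside E) g) z)"
    by (simp add: regular_compact_def)
  also have "(\<lambda>z. if z \<in> E then 0 else (SOME g. is_green_function (outside E) g) z) = green E"
    by (auto simp: green_def out)
  finally show ?thesis .
qed

lemma regular_compact_if_extended_green:
  assumes "polynomially_convex E" "extended_green E G"
  shows "regular_compact E"
proof -
  have "compact E" using assms(1) by (rule polynomially_convex_imp_compact)
  with extended_green_imp_is_green_function[OF this assms(2)] show ?thesis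
    unfolding regular_compact_def polynomially_convex_outside[OF assms(1)] by blast
qed

lemma klimek_family_iff:
  "K \<in> klimek_family \<longleftrightarrow> polynomially_convex K \<and> regular_compact K"
  using polynomially_convex_imp_compact[of K] unfolding klimek_family_def by auto

lemma green_eqI:
  assumes "polynomially_convex E" "extended_green E G"
  shows "green E = G"
  using extended_green_unique[OF extended_green_green[OF assms(1)
    regular_compact_if_extended_green[OF assms]] assms(2)] .

subsection \<open>Preimages under polynomials\<close>

lemma poly_surj:
  assumes "degree (P :: complex poly) \<ge> 1"
  shows "\<exists>z. poly P z = w"
proof -
  have "\<not> constant (poly (P - [:w:]))"
    using assms constant_degree[of "P - [:w:]"] degree_add_eq_left[of "[:- w:]" P]
    by (simp add: diff_conv_add_uminus del: add_uminus_conv_diff)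
  from fundamental_theorem_of_algebra[OF this] show ?thesis by auto
qed

lemma poly_at_infinity: "degree (P :: complex poly) \<ge> 1 \<Longrightarrow> filterlim (poly P) at_infinity at_infinity"
  by (rule filterlim_poly_at_infinity) simp

lemma compact_poly_vimage:
  assumes "degree (P :: complex poly) \<ge> 1" "compact E"
  shows "compact (poly P -` E)"
proof -
  from compact_imp_bounded[OF assms(2)] obtain B where B: "\<And>z. z \<in> E \<Longrightarrow> norm z \<le> B"
    unfolding bounded_iff by blast
  have "eventually (\<lambda>z. norm (poly P z) > B) at_infinity"
    using filterlim_compose[OF filterlim_norm_at_top poly_at_infinity[OF assms(1)]]
    by (simp add: filterlim_at_top_dense)
  then have "eventually (\<lambda>z. \<not> poly P z \<in> E) at_infinity"
    by eventually_elim (use B in force)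
  then have "bounded (poly P -` E)"
    unfolding vimage_def by (rule bounded_Collect_if_eventually_not)
  moreover have "closed (poly P -` E)"
    using assms(2) by (intro continuous_closed_vimage compact_imp_closed) auto
  ultimately show ?thesis by (simp add: compact_eq_bounded_closed)
qed

lemma polynomially_convex_poly_vimage:
  assumes "degree P \<ge> 1" "polynomially_convex E" "E \<noteq> {}"
  shows "polynomially_convex (poly P -` E)"
proof (rule polynomially_convexI)
  have E: "compact E" using assms(2) by (rule polynomially_convex_imp_compact)
  show "compact (poly P -` E)" using compact_poly_vimage assms(1) E .
  show "poly P -` E \<noteq> {}" using assms(3) poly_surj[OF assms(1)] by (metis ex_in_conv vimageI2)
  fix z assume "z \<notin> poly P -` E"
  then have "poly P z \<notin> E" by simp
  then obtain q where q: "norm (poly q (poly P z)) > (SUP w\<in>E. norm (poly q w))"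
    by (rule polynomially_convex_separation[OF assms(2)])
  have "bdd_above ((\<lambda>w. norm (poly q w)) ` E)"
    by (intro bounded_imp_bdd_above compact_imp_bounded compact_continuous_image)
      (auto intro!: continuous_intros E)
  then show "\<exists>q B. (\<forall>w\<in>poly P -` E. norm (poly q w) \<le> B) \<and> B < norm (poly q z)"
    using q by (intro exI[of _ "pcompose q P"] exI[of _ "SUP w\<in>E. norm (poly q w)"])
      (auto simp: poly_pcompose intro: cSUP_upper2)
qed

lemma ln_norm_poly_tendsto:
  assumes "degree (P :: complex poly) \<ge> 1"
  shows "((\<lambda>z. ln (norm (poly P z)) / real (degree P) - ln (norm z)) \<longlongrightarrow>
    ln (norm (lead_coeff P)) / real (degree P)) at_infinity"
proof -
  have "((\<lambda>z. ln (norm (poly P z / z ^ degree P)) / real (degree P)) \<longlongrightarrow>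
    ln (norm (lead_coeff P)) / real (degree P)) at_infinity"
    using assms by (intro tendsto_intros poly_divide_tendsto_aux) auto
  then show ?thesis
  proof (rule Lim_transform_eventually)
    have "eventually (\<lambda>z. norm (poly P z) \<ge> 1) at_infinity"
      using filterlim_compose[OF filterlim_norm_at_top poly_at_infinity[OF assms]]
      by (simp add: filterlim_at_top)
    moreover have "eventually (\<lambda>z::complex. norm z \<ge> 1) at_infinity"
      by (auto simp: eventually_at_infinity)
    ultimately show "\<forall>\<^sub>F z in at_infinity. ln (norm (poly P z / z ^ degree P)) / real (degree P)
        = ln (norm (poly P z)) / real (degree P) - ln (norm z)"
    proof eventually_elim
      case (elim z)
      then have "norm (poly P z) > 0" "norm z > 0" by linarith+
      then show ?case using assms
        by (simp add: norm_divide norm_power ln_div ln_realpow diff_divide_distrib)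
    qed
  qed
qed

lemma extended_green_poly_vimage:
  assumes "degree P \<ge> 1" "compact E" "extended_green E G"
  shows "extended_green (poly P -` E) (\<lambda>z. G (poly P z) / real (degree P))"
  unfolding extended_green_def
proof (intro conjI ballI)
  let ?d = "real (degree P)"
  have G: "continuous_on UNIV G" "\<And>z. z \<in> E \<Longrightarrow> G z = 0" "\<And>z. z \<in> - E \<Longrightarrow> G z > 0"
    "harmonic_on G (- E)" using assms(3) by (auto simp: extended_green_def)
  from assms(3) obtain c where c: "((\<lambda>z. G z - ln (norm z)) \<longlongrightarrow> c) at_infinity"
    by (auto simp: extended_green_def)
  show "continuous_on UNIV (\<lambda>z. G (poly P z) / ?d)"
    using assms(1) by (intro continuous_intros continuous_on_compose2[OF G(1)]) auto
  show "G (poly P z) / ?d = 0" if "z \<in> poly P -` E" for z using G(2) that by simp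
  show "G (poly P z) / ?d > 0" if "z \<in> - (poly P -` E)" for z using G(3) that assms(1) by simp
  have "open (- (poly P -` E))"
    using compact_poly_vimage[OF assms(1,2)] by (simp add: compact_imp_closed open_Compl)
  then have "harmonic_on (\<lambda>z. G (poly P z)) (- (poly P -` E))"
    by (intro harmonic_on_compose_holomorphic[OF G(4)]) (auto intro!: holomorphic_intros)
  from harmonic_on_linear_combination[OF this this, of "1 / ?d" 0]
  show "harmonic_on (\<lambda>z. G (poly P z) / ?d) (- (poly P -` E))" by simp
  have "((\<lambda>z. (G (poly P z) - ln (norm (poly P z))) / ?d
      + (ln (norm (poly P z)) / ?d - ln (norm z))) \<longlongrightarrow> c / ?d + ln (norm (lead_coeff P)) / ?d) at_infinity"
    using assms(1)
    by (intro tendsto_add tendsto_divide tendsto_const ln_norm_poly_tendsto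
        filterlim_compose[OF c poly_at_infinity[OF assms(1)]]) auto
  then show "\<exists>c. ((\<lambda>z. G (poly P z) / ?d - ln (norm z)) \<longlongrightarrow> c) at_infinity"
    by (auto simp: diff_divide_distrib)
qed

lemma poly_vimage_klimek_family:
  assumes "degree P \<ge> 1" "E \<in> klimek_family"
  shows "poly P -` E \<in> klimek_family"
    and "green (poly P -` E) = (\<lambda>z. green E (poly P z) / real (degree P))"
proof -
  have E: "polynomially_convex E" "regular_compact E" "compact E"
    using assms(2) polynomially_convex_imp_compact unfolding klimek_family_iff by blast+
  note g = extended_green_green[OF E(1,2)]
  note pc = polynomially_convex_poly_vimage[OF assms(1) E(1) extended_green_nonempty[OF g]]
  note g' = extended_green_poly_vimage[OF assms(1) E(3) g]
  show "poly P -` E \<in> klimek_family"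
    using pc regular_compact_if_extended_green[OF pc g'] by (simp add: klimek_family_iff)
  show "green (poly P -` E) = (\<lambda>z. green E (poly P z) / real (degree P))"
    using green_eqI[OF pc g'] .
qed

section \<open>Uniform bounds for the leading coefficients\<close>

lemma poly_eq_lead_coeff_times_roots:
  fixes P :: "complex poly"
  assumes "P \<noteq> 0"
  obtains A where "size A = degree P" "\<And>x. x \<in># A \<Longrightarrow> poly P x = 0"
    "\<And>z. poly P z = lead_coeff P * (\<Prod>x\<in>#A. z - x)"
proof -
  from alg_closed_imp_factorization[OF assms] obtain A where
    A: "size A = degree P" "P = smult (lead_coeff P) (\<Prod>x\<in>#A. [:- x, 1:])" by blast
  have eval: "poly (\<Prod>x\<in>#B. [:- x, 1:]) z = (\<Prod>x\<in>#B. z - x)" for B and z :: complex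
    by (induction B) (auto simp: algebra_simps)
  have ev: "poly P z = lead_coeff P * (\<Prod>x\<in>#A. z - x)" for z
    by (subst A(2)) (simp add: eval)
  have "poly P x = 0" if "x \<in># A" for x
    using that by (auto simp: ev prod_mset_zero_iff image_iff)
  with A(1) ev that show ?thesis by blast
qed

lemma norm_poly_bounds:
  fixes P :: "complex poly"
  assumes "P \<noteq> 0" and zeros: "\<And>x. poly P x = 0 \<Longrightarrow> norm x \<le> r"
  shows "norm (poly P z) \<le> norm (lead_coeff P) * (norm z + r) ^ degree P"
    and "norm z \<ge> r \<Longrightarrow> norm (lead_coeff P) * (norm z - r) ^ degree P \<le> norm (poly P z)"
proof -
  obtain A where A: "size A = degree P" "\<And>x. x \<in># A \<Longrightarrow> poly P x = 0"
    "\<And>z. poly P z = lead_coeff P * (\<Prod>x\<in>#A. z - x)"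
    using poly_eq_lead_coeff_times_roots[OF assms(1)] by blast
  have A': "norm x \<le> r" if "x \<in># A" for x using A(2) that zeros by blast
  have upper: "norm (\<Prod>x\<in>#B. z - x) \<le> (norm z + r) ^ size B" if "B \<subseteq># A" for B
    using that
  proof (induction B)
    case (add x B)
    then have x: "norm x \<le> r" and B: "B \<subseteq># A"
      using A' mset_subset_eq_insertD[of x B A] by (auto simp: subset_mset.less_imp_le)
    have "norm (z - x) \<le> norm z + r" using norm_triangle_ineq4[of z x] x by linarith
    moreover have "r \<ge> 0" using x norm_ge_zero[of x] by linarith
    ultimately show ?case using add.IH[OF B]
      by (auto simp: norm_mult intro!: mult_mono)
  qed auto
  have lower: "(norm z - r) ^ size B \<le> norm (\<Prod>x\<in>#B. z - x)" if "norm z \<ge> r" "B \<subseteq># A" for B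
    using that(2)
  proof (induction B)
    case (add x B)
    then have x: "norm x \<le> r" and B: "B \<subseteq># A"
      using A' mset_subset_eq_insertD[of x B A] by (auto simp: subset_mset.less_imp_le)
    have "norm z - r \<le> norm (z - x)" using norm_triangle_ineq2[of z x] x by linarith
    with add.IH[OF B] x that(1) show ?case
      by (auto simp: norm_mult intro!: mult_mono)
  qed auto
  show "norm (poly P z) \<le> norm (lead_coeff P) * (norm z + r) ^ degree P"
    using upper[of A] A(1) by (simp add: A(3) norm_mult mult_left_mono)
  show "norm (lead_coeff P) * (norm z - r) ^ degree P \<le> norm (poly P z)" if "norm z \<ge> r"
    using lower[of A] that A(1) by (simp add: A(3) norm_mult mult_left_mono)
qed

lemma higher_deriv_poly: "(deriv ^^ n) (poly P) = poly ((pderiv ^^ n) P)"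
  for P :: "complex poly"
proof (induction n)
  case (Suc n)
  have "deriv (poly Q) = poly (pderiv Q)" for Q :: "complex poly"
    by (intro ext DERIV_imp_deriv poly_DERIV)
  with Suc show ?case by simp
qed simp

text \<open>Cauchy's estimate for the derivative of order \<open>degree P\<close>, which is constant.\<close>

lemma norm_lead_coeff_le:
  fixes P :: "complex poly"
  assumes "\<rho> > 0" and bound: "\<And>z. z \<in> cball c \<rho> \<Longrightarrow> norm (poly P z) \<le> B"
  shows "norm (lead_coeff P) * \<rho> ^ degree P \<le> B"
proof -
  let ?d = "degree P"
  have "coeff ((pderiv ^^ ?d) P) n = coeff [:fact ?d * lead_coeff P:] n" for n
    by (cases n) (auto simp: coeff_higher_pderiv pochhammer_fact coeff_eq_0)
  then have "(pderiv ^^ ?d) P = [:fact ?d * lead_coeff P:]" by (rule poly_eqI)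
  then have "(deriv ^^ ?d) (poly P) c = fact ?d * lead_coeff P"
    by (simp add: higher_deriv_poly)
  moreover have "norm ((deriv ^^ ?d) (poly P) c) \<le> fact ?d * B / \<rho> ^ ?d"
    by (rule Cauchy_inequality)
      (use assms in \<open>auto intro!: holomorphic_intros continuous_intros simp: dist_norm\<close>)
  ultimately have "fact ?d * norm (lead_coeff P) \<le> fact ?d * (B / \<rho> ^ ?d)"
    by (simp add: norm_mult norm_fact)
  then show ?thesis using assms(1) by (simp add: field_simps)
qed

text \<open>The uniform boundedness principle for functions with closed sublevel sets.\<close>

lemma pointwise_bounded_imp_uniformly_bounded_on_cball:
  fixes f :: "'i \<Rightarrow> 'a::{real_normed_vector,heine_borel} \<Rightarrow> real"
  assumes D: "open D" "D \<noteq> {}"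
    and closed: "\<And>i k::nat. i \<in> I \<Longrightarrow> closed {z. f i z \<le> real k}"
    and bdd: "\<And>z. z \<in> D \<Longrightarrow> bdd_above ((\<lambda>i. f i z) ` I)"
  obtains c \<rho> and k :: nat where "\<rho> > 0" "\<And>z i. z \<in> cball c \<rho> \<Longrightarrow> i \<in> I \<Longrightarrow> f i z \<le> real k"
proof -
  define T where "T = (\<lambda>k::nat. (\<Inter>i\<in>I. {z. f i z \<le> real k}))"
  have "\<exists>k. interior (T k) \<noteq> {}"
  proof (rule ccontr)
    assume "\<not> ?thesis"
    then have int: "interior (T k) = {}" for k by blast
    have "closed (T k)" for k unfolding T_def using closed by (intro closed_INT) auto
    with int have "UNIV \<subseteq> closure (\<Inter>(range (\<lambda>k. - T k)))"
      by (intro Baire) (auto simp: closure_complement open_Compl)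
    moreover have "D \<inter> \<Inter>(range (\<lambda>k. - T k)) = {}"
    proof -
      have "\<exists>k. z \<in> T k" if z: "z \<in> D" for z
      proof -
        from bdd[OF z] obtain B where "\<And>i. i \<in> I \<Longrightarrow> f i z \<le> B"
          by (auto simp: bdd_above_def)
        moreover obtain k where "B \<le> real k" using real_arch_simple by blast
        ultimately show ?thesis unfolding T_def by (force intro: order_trans)
      qed
      then show ?thesis by blast
    qed
    ultimately have "D = {}" using D(1) open_Int_closure_eq_empty by blast
    with D(2) show False by simp
  qed
  then obtain k c where "c \<in> interior (T k)" by blast
  then obtain \<rho> where "\<rho> > 0" "cball c \<rho> \<subseteq> T k" unfolding mem_interior_cball by blast
  then show ?thesis by (intro that[of \<rho> c k]) (auto simp: T_def)
qed

lemma log_plus_le_iff: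
  assumes "y \<ge> 0" "c \<ge> 0"
  shows "log_plus y \<le> c \<longleftrightarrow> y \<le> exp c"
proof (cases "y = 0")
  case False
  with assms have "y > 0" by simp
  then have "ln y \<le> c \<longleftrightarrow> y \<le> exp c" by (metis exp_le_cancel_iff exp_ln)
  with assms show ?thesis by (simp add: log_plus_def)
qed (use assms in \<open>simp add: log_plus_def\<close>)

text \<open>The upper bound comes from uniform boundedness on some disc. For the lower bound, positivity of
  \<open>log_plus\<close> at the single point \<open>\<zeta>\<close> means \<open>\<bar>p n \<zeta>\<bar> > 1\<close>, whereas \<open>\<bar>p n \<zeta>\<bar>\<close> is at most
  \<open>(\<bar>\<zeta>\<bar> + r)\<^sup>d \<bar>lead_coeff (p n)\<bar>\<close>; the finitely many indices below \<open>N\<close> only enlarge the constant.\<close>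

lemma lead_coeff_bounds:
  fixes p :: "nat \<Rightarrow> complex poly" and h :: "complex \<Rightarrow> real"
  assumes deg: "\<And>n. n \<ge> 1 \<Longrightarrow> degree (p n) \<ge> 1"
    and zeros: "\<And>n z. n \<ge> 1 \<Longrightarrow> poly (p n) z = 0 \<Longrightarrow> norm z \<le> r"
    and r: "r > 0"
    and lower: "\<And>n. n \<ge> N \<Longrightarrow> 1 / real (degree (p n)) * log_plus (norm (poly (p n) \<zeta>)) > 0"
    and D: "open D" "D \<noteq> {}"
    and bdd: "\<And>z. z \<in> D \<Longrightarrow>
        bdd_above ((\<lambda>n. 1 / real (degree (p n)) * log_plus (norm (poly (p n) z))) ` {1..})"
  obtains A where "A \<ge> 1" "\<And>n. n \<ge> 1 \<Longrightarrow> norm (lead_coeff (p n)) \<le> A ^ degree (p n)"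
    "\<And>n. n \<ge> 1 \<Longrightarrow> 1 \<le> A ^ degree (p n) * norm (lead_coeff (p n))"
proof -
  let ?d = "\<lambda>n. degree (p n)"
  have nz: "p n \<noteq> 0" if "n \<ge> 1" for n using deg[OF that] by auto
  have iff: "1 / real (?d n) * log_plus (norm (poly (p n) z)) \<le> real k
      \<longleftrightarrow> norm (poly (p n) z) \<le> exp (real k * real (?d n))" if "n \<ge> 1" for n z k
    using deg[OF that] log_plus_le_iff[of "norm (poly (p n) z)" "real k * real (?d n)"]
    by (simp add: field_simps)
  obtain c \<rho> and k :: nat where \<rho>: "\<rho> > 0" and
    ball: "\<And>z n. z \<in> cball c \<rho> \<Longrightarrow> n \<in> {1..} \<Longrightarrow>
        1 / real (?d n) * log_plus (norm (poly (p n) z)) \<le> real k"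
  proof (rule pointwise_bounded_imp_uniformly_bounded_on_cball[OF D])
    fix n k :: nat assume "n \<in> {1..}"
    then have "n \<ge> 1" by simp
    show "closed {z. 1 / real (?d n) * log_plus (norm (poly (p n) z)) \<le> real k}"
      unfolding iff[OF \<open>n \<ge> 1\<close>] by (intro closed_Collect_le continuous_intros)
  qed (use bdd in auto)
  have upper: "norm (lead_coeff (p n)) \<le> (exp (real k) / \<rho>) ^ ?d n" if n: "n \<ge> 1" for n
  proof -
    have "norm (poly (p n) z) \<le> exp (real k * real (?d n))" if "z \<in> cball c \<rho>" for z
      using iff[OF n] ball[OF that] n by auto
    then have "norm (lead_coeff (p n)) * \<rho> ^ ?d n \<le> exp (real k * real (?d n))"
      by (rule norm_lead_coeff_le[OF \<rho>])
    moreover have "exp (real k * real (?d n)) = exp (real k) ^ ?d n"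
      using exp_of_nat_mult[of "?d n" "real k"] by (simp add: mult.commute)
    ultimately show ?thesis using \<rho> by (simp add: power_divide field_simps)
  qed
  have low: "1 \<le> (norm \<zeta> + r) ^ ?d n * norm (lead_coeff (p n))" if "n \<ge> 1" "n \<ge> N" for n
  proof -
    have "log_plus (norm (poly (p n) \<zeta>)) > 0"
      using lower[OF that(2)] deg[OF that(1)] by (simp add: zero_less_mult_iff zero_less_divide_iff)
    then have "norm (poly (p n) \<zeta>) > 1"
      using log_plus_le_iff[of "norm (poly (p n) \<zeta>)" 0] by simp
    with norm_poly_bounds(1)[OF nz[OF that(1)] zeros[OF that(1)], of \<zeta>] show ?thesis
      by (simp add: mult.commute)
  qed
  define A where "A = Max (insert 1 (insert (exp (real k) / \<rho>) (insert (norm \<zeta> + r)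
      ((\<lambda>n. 1 / norm (lead_coeff (p n))) ` {1..<N}))))"
  have fin: "finite (insert 1 (insert (exp (real k) / \<rho>) (insert (norm \<zeta> + r)
      ((\<lambda>n. 1 / norm (lead_coeff (p n))) ` {1..<N}))))" by simp
  have A: "A \<ge> 1" "A \<ge> exp (real k) / \<rho>" "A \<ge> norm \<zeta> + r"
    unfolding A_def by (rule Max_ge[OF fin], simp)+
  have A_small: "A \<ge> 1 / norm (lead_coeff (p n))" if "1 \<le> n" "n < N" for n
    unfolding A_def by (rule Max_ge[OF fin]) (use that in auto)
  show ?thesis
  proof (rule that[OF A(1)])
    fix n :: nat assume n: "n \<ge> 1"
    show "norm (lead_coeff (p n)) \<le> A ^ ?d n"
      using upper[OF n] power_mono[OF A(2), of "?d n"] \<rho> by simp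
    have pos: "norm (lead_coeff (p n)) > 0" using nz[OF n] by simp
    show "1 \<le> A ^ ?d n * norm (lead_coeff (p n))"
    proof (cases "n < N")
      case True
      have "1 / norm (lead_coeff (p n)) \<le> A" using A_small[OF n True] .
      also have "A \<le> A ^ ?d n" using self_le_power[OF A(1)] deg[OF n] by simp
      finally show ?thesis using pos by (simp add: field_simps)
    next
      case False
      have "(norm \<zeta> + r) ^ ?d n * norm (lead_coeff (p n)) \<le> A ^ ?d n * norm (lead_coeff (p n))"
        using A(3) r by (intro mult_right_mono power_mono) auto
      with low[of n] n False show ?thesis by simp
    qed
  qed
qed

section \<open>The escape rate of a sequence of polynomials\<close>

text \<open>The Green function of the disc of radius \<open>R\<close>, extended by 0.\<close>

definition disc_green :: "real \<Rightarrow> complex \<Rightarrow> real" where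
  "disc_green R w = ln (max 1 (norm w / R))"

lemma disc_green_nonneg: "disc_green R w \<ge> 0"
  by (simp add: disc_green_def)

lemma disc_green_eq_0_iff:
  assumes "R > 0"
  shows "disc_green R w = 0 \<longleftrightarrow> norm w \<le> R"
proof -
  have "disc_green R w = 0 \<longleftrightarrow> max 1 (norm w / R) = 1"
    unfolding disc_green_def by (rule ln_eq_zero_iff) simp
  also have "\<dots> \<longleftrightarrow> norm w / R \<le> 1" by (auto simp: max_def)
  finally show ?thesis using assms by simp
qed

lemma disc_green_outside: "R > 0 \<Longrightarrow> norm w \<ge> R \<Longrightarrow> disc_green R w = ln (norm w) - ln R"
  by (auto simp: disc_green_def max_def ln_div)

lemma continuous_on_disc_green: "R > 0 \<Longrightarrow> continuous_on S (disc_green R)"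
  unfolding disc_green_def by (intro continuous_intros) (auto simp: max_def)

lemma disc_green_le:
  assumes "R > 0" "norm v \<le> norm w"
  shows "disc_green R v \<le> disc_green R w"
proof -
  have "max 1 (norm v / R) \<le> max 1 (norm w / R)"
    using assms by (intro max.mono divide_right_mono) auto
  then show ?thesis unfolding disc_green_def by (rule iffD2[OF ln_le_cancel_iff, rotated 2]) simp_all
qed

text \<open>The difference is continuous and has a finite limit at infinity, because both functions differ
  from \<open>ln \<bar>z\<bar>\<close> by a convergent quantity.\<close>

lemma extended_green_minus_disc_green_bounded:
  assumes "extended_green E G" "R > 0"
  obtains C where "\<And>z. \<bar>G z - disc_green R z\<bar> \<le> C"
proof -
  define \<phi> where "\<phi> = (\<lambda>z. G z - disc_green R z)"
  have cont: "continuous_on UNIV \<phi>"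
    using assms continuous_on_disc_green unfolding \<phi>_def extended_green_def
    by (auto intro!: continuous_intros)
  from assms obtain c where c: "((\<lambda>z. G z - ln (norm z)) \<longlongrightarrow> c) at_infinity"
    by (auto simp: extended_green_def)
  have "(\<phi> \<longlongrightarrow> c + ln R) at_infinity"
  proof (rule Lim_transform_eventually[OF tendsto_add[OF c tendsto_const]])
    have "eventually (\<lambda>z::complex. norm z \<ge> R) at_infinity"
      by (auto simp: eventually_at_infinity)
    then show "\<forall>\<^sub>F z in at_infinity. G z - ln (norm z) + ln R = \<phi> z"
      by eventually_elim (simp add: \<phi>_def disc_green_outside assms(2))
  qed
  then have "eventually (\<lambda>z. dist (\<phi> z) (c + ln R) < 1) at_infinity"
    by (rule tendstoD) simp
  then obtain b where b: "\<And>z. norm z \<ge> b \<Longrightarrow> dist (\<phi> z) (c + ln R) < 1"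
    by (auto simp: eventually_at_infinity)
  have "bounded (\<phi> ` cball 0 b)"
    using continuous_on_subset[OF cont] by (intro compact_imp_bounded compact_continuous_image) auto
  then obtain B where "\<forall>x\<in>\<phi> ` cball 0 b. norm x \<le> B" unfolding bounded_iff by blast
  then have B: "\<bar>\<phi> z\<bar> \<le> B" if "norm z \<le> b" for z using that by simp
  have "\<bar>\<phi> z\<bar> \<le> max B (\<bar>c + ln R\<bar> + 1)" for z
    using B[of z] b[of z] by (cases "norm z \<le> b") (auto simp: dist_real_def)
  then show ?thesis using that unfolding \<phi>_def by blast
qed

primrec comp_poly :: "(nat \<Rightarrow> complex poly) \<Rightarrow> nat \<Rightarrow> complex poly" where
  "comp_poly p 0 = [:0, 1:]"
| "comp_poly p (Suc n) = pcompose (p (Suc n)) (comp_poly p n)"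

lemma poly_comp_poly: "poly (comp_poly p n) z = poly_iter p n z"
  by (induction n) (auto simp: poly_pcompose)

declare comp_poly.simps(2) [simp del]

lemma poly_iter_eq_poly: "poly_iter p n = poly (comp_poly p n)"
  by (simp add: fun_eq_iff poly_comp_poly)

text \<open>All that the dynamical estimates need besides the degrees is that all zeros lie in one
  disc and \<open>\<bar>lead_coeff (p n)\<bar>\<^bsup>1/d\<^esup>\<close>, with \<open>d\<close> the degree of \<open>p n\<close>, stays between two positive
  constants.\<close>

locale coefficient_bounded_sequence =
  fixes p :: "nat \<Rightarrow> complex poly" and r A :: real
  assumes degree_1: "degree (p 1) \<ge> 1"
    and degree_ge_2: "n \<ge> 2 \<Longrightarrow> degree (p n) \<ge> 2"
    and zeros_bound: "n \<ge> 1 \<Longrightarrow> poly (p n) z = 0 \<Longrightarrow> norm z \<le> r"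
    and r_pos: "r > 0" and A_ge_1: "A \<ge> 1"
    and lead_upper: "n \<ge> 1 \<Longrightarrow> norm (lead_coeff (p n)) \<le> A ^ degree (p n)"
    and lead_lower: "n \<ge> 1 \<Longrightarrow> 1 \<le> A ^ degree (p n) * norm (lead_coeff (p n))"
begin

text \<open>A common escape radius: \<open>2 r\<close> makes the distance of \<open>w\<close> to every zero at least \<open>\<bar>w\<bar>/2\<close> when
  \<open>\<bar>w\<bar> \<ge> R\<close>, and \<open>(2 A)\<^sup>2\<close> compensates for small leading coefficients.\<close>

definition R :: real where "R = 4 * A\<^sup>2 + 2 * r"

text \<open>Bounds the amount by which \<open>p n\<close> can raise \<open>disc_green R\<close>, after division by its degree.\<close>

definition M :: real where "M = ln (2 * A * R)"

abbreviation D :: "nat \<Rightarrow> nat" where "D n \<equiv> degree (comp_poly p n)"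

text \<open>The Green function of the preimage of the disc of radius \<open>R\<close> under the \<open>n\<close>-th composition.\<close>

definition g :: "nat \<Rightarrow> complex \<Rightarrow> real" where
  "g n z = disc_green R (poly_iter p n z) / real (D n)"

definition escape_rate :: "complex \<Rightarrow> real" where
  "escape_rate z = lim (\<lambda>n. g n z)"

lemma degree_ge_1: "n \<ge> 1 \<Longrightarrow> degree (p n) \<ge> 1"
  using degree_1 degree_ge_2[of n] by (cases "n = 1") auto

lemma p_nonzero: "n \<ge> 1 \<Longrightarrow> p n \<noteq> 0"
  using degree_ge_1[of n] by auto

lemma R_bounds: "R \<ge> 2 * r" "R \<ge> 4 * A\<^sup>2" "R \<ge> 4"
proof -
  have "A\<^sup>2 \<ge> 1" using A_ge_1 by (rule one_le_power)
  then show "R \<ge> 2 * r" "R \<ge> 4 * A\<^sup>2" "R \<ge> 4" using r_pos by (auto simp: R_def)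
qed

lemma R_pos: "R > 0" using R_bounds by simp

lemma M_nonneg: "M \<ge> 0"
proof -
  have "1 * 1 \<le> (2 * A) * R" using A_ge_1 R_bounds by (intro mult_mono) auto
  then show ?thesis by (simp add: M_def)
qed

text \<open>The product of the distances to the zeros is at least \<open>(\<bar>w\<bar>/2)\<^sup>d\<close> for \<open>\<bar>w\<bar> \<ge> 2 r\<close>, so
  \<open>\<bar>p w\<bar> \<ge> (\<bar>w\<bar>/(2 A))\<^sup>d\<close>. The claim then reduces to \<open>R\<^bsup>d-1\<^esup> \<ge> (2 A)\<^sup>d\<close>, which is where \<open>d \<ge> 2\<close> and
  \<open>R \<ge> (2 A)\<^sup>2\<close> come in.\<close>

lemma norm_poly_div_R_ge:
  assumes n: "n \<ge> 2" and w: "norm w \<ge> R"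
  shows "norm (poly (p n) w) / R \<ge> (norm w / R) ^ degree (p n)"
proof -
  let ?d = "degree (p n)" and ?a = "norm (lead_coeff (p n))"
  have n1: "n \<ge> 1" using n by simp
  have d: "?d \<ge> 2" using degree_ge_2[OF n] .
  have "(2 * A) ^ ?d \<le> (2 * A) ^ (2 * (?d - 1))"
    using A_ge_1 d by (intro power_increasing) auto
  also have "\<dots> = (4 * A\<^sup>2) ^ (?d - 1)" by (simp add: power_mult power_mult_distrib)
  also have "\<dots> \<le> R ^ (?d - 1)" using R_bounds by (intro power_mono) auto
  finally have "(2 * A) ^ ?d * R \<le> R ^ (?d - 1) * R" using R_pos by simp
  also have "R ^ (?d - 1) * R = R ^ ?d" using d by (intro power_minus_mult) simp
  finally have RA: "R * (2 * A) ^ ?d \<le> R ^ ?d" by (simp add: mult.commute)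
  have "norm w ^ ?d \<le> (2 * (norm w - r)) ^ ?d"
    using w R_bounds r_pos by (intro power_mono) auto
  also have "\<dots> = 2 ^ ?d * (norm w - r) ^ ?d * 1" by (simp only: power_mult_distrib mult_1_right)
  also have "\<dots> \<le> 2 ^ ?d * (norm w - r) ^ ?d * (A ^ ?d * ?a)"
    using lead_lower[OF n1] w R_bounds r_pos by (intro mult_left_mono) auto
  also have "\<dots> = (2 * A) ^ ?d * (?a * (norm w - r) ^ ?d)" by (simp add: power_mult_distrib)
  also have "\<dots> \<le> (2 * A) ^ ?d * norm (poly (p n) w)"
    using norm_poly_bounds(2)[OF p_nonzero[OF n1] zeros_bound[OF n1], of w] w R_bounds r_pos A_ge_1
    by (intro mult_left_mono) auto
  finally have "R * norm w ^ ?d \<le> R * (2 * A) ^ ?d * norm (poly (p n) w)"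
    using R_pos by simp
  also have "\<dots> \<le> R ^ ?d * norm (poly (p n) w)" using RA by (rule mult_right_mono) simp
  finally show ?thesis using R_pos by (simp add: power_divide field_simps)
qed

lemma disc_green_poly_ge:
  assumes n: "n \<ge> 2"
  shows "disc_green R w \<le> disc_green R (poly (p n) w) / real (degree (p n))"
proof (cases "norm w \<le> R")
  case True
  then have "disc_green R w = 0" using disc_green_eq_0_iff[OF R_pos] by blast
  then show ?thesis by (simp add: disc_green_nonneg)
next
  case False
  let ?d = "degree (p n)"
  have d: "?d \<ge> 2" using degree_ge_2[OF n] .
  have x: "norm w / R > 1" using False R_pos by simp
  then have "(norm w / R) ^ ?d \<le> max 1 (norm (poly (p n) w) / R)"
    using norm_poly_div_R_ge[OF n, of w] False by simp
  then have "ln ((norm w / R) ^ ?d) \<le> disc_green R (poly (p n) w)"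
    unfolding disc_green_def
    by (rule iffD2[OF ln_le_cancel_iff, rotated 2]) (use x in \<open>simp_all only: zero_less_power less_trans[OF zero_less_one x] less_max_iff_disj zero_less_one simp_thms\<close>)
  also have "ln ((norm w / R) ^ ?d) = ?d * disc_green R w"
    using x by (subst ln_realpow) (auto simp: disc_green_def max_def)
  finally show ?thesis using d by (simp add: field_simps)
qed

text \<open>The factors \<open>\<bar>w - \<zeta>\<bar>\<close> are at most \<open>\<bar>w\<bar> + r\<close>, hence at most \<open>2 R max 1 (\<bar>w\<bar>/R)\<close>.\<close>

lemma disc_green_poly_le:
  assumes n: "n \<ge> 1"
  shows "disc_green R (poly (p n) w) / real (degree (p n)) \<le> disc_green R w + M"
proof -
  let ?d = "degree (p n)"
  define x where "x = max 1 (norm w / R)"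
  have d: "?d \<ge> 1" using degree_ge_1[OF n] .
  have x: "x \<ge> 1" by (simp add: x_def)
  have AR: "2 * A * R \<ge> 1" using M_nonneg A_ge_1 R_pos by (simp add: M_def)
  have "norm w \<le> R * x" using R_pos by (simp add: x_def max_def field_simps)
  moreover have "r \<le> R * x" using R_bounds r_pos x R_pos mult_left_mono[of 1 x R] by linarith
  ultimately have wr: "A * (norm w + r) \<le> 2 * A * R * x"
    using A_ge_1 mult_left_mono[of "norm w + r" "2 * R * x" A] by (simp add: algebra_simps)
  have "norm (poly (p n) w) \<le> norm (lead_coeff (p n)) * (norm w + r) ^ ?d"
    using norm_poly_bounds(1)[OF p_nonzero[OF n] zeros_bound[OF n]] .
  also have "\<dots> \<le> A ^ ?d * (norm w + r) ^ ?d"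
    using lead_upper[OF n] r_pos by (intro mult_right_mono) auto
  also have "\<dots> = (A * (norm w + r)) ^ ?d" by (simp add: power_mult_distrib)
  also have "\<dots> \<le> (2 * A * R * x) ^ ?d" using wr A_ge_1 r_pos by (intro power_mono) auto
  finally have "norm (poly (p n) w) \<le> (2 * A * R * x) ^ ?d" .
  moreover have "norm (poly (p n) w) / R \<le> norm (poly (p n) w)"
    using R_bounds(3) mult_left_mono[of 1 R "norm (poly (p n) w)"] by (simp add: divide_le_eq)
  ultimately have "norm (poly (p n) w) / R \<le> (2 * A * R * x) ^ ?d" by linarith
  moreover have "1 * 1 \<le> (2 * A * R) * x" using AR x by (intro mult_mono) auto
  then have ge1: "1 \<le> 2 * A * R * x" by simp
  then have "1 \<le> (2 * A * R * x) ^ ?d" by (rule one_le_power)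
  ultimately have "disc_green R (poly (p n) w) \<le> ln ((2 * A * R * x) ^ ?d)"
    unfolding disc_green_def by (subst ln_le_cancel_iff) auto
  also have "\<dots> = ?d * ln (2 * A * R * x)" using ge1 by (subst ln_realpow) auto
  also have "ln (2 * A * R * x) = M + disc_green R w"
    unfolding M_def disc_green_def x_def[symmetric] using AR x by (subst ln_mult) auto
  finally show ?thesis using d by (simp add: field_simps)
qed

lemma D_Suc: "D (Suc n) = degree (p (Suc n)) * D n"
  by (simp add: comp_poly.simps(2) degree_pcompose)

lemma D_ge: "n \<ge> 1 \<Longrightarrow> 2 ^ n \<le> 2 * D n"
proof (induction n rule: nat_induct_at_least)
  case base
  then show ?case using degree_1 D_Suc[of 0] by simp
next
  case (Suc n)
  have "2 * 2 ^ n \<le> degree (p (Suc n)) * (2 * D n)"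
    using Suc degree_ge_2[of "Suc n"] by (intro mult_mono) auto
  then show ?case by (simp add: D_Suc)
qed

lemma D_pos: "n \<ge> 1 \<Longrightarrow> D n \<ge> 1"
  using D_ge[of n] by (metis One_nat_def Suc_leI gr0I mult_0_right not_le zero_less_numeral zero_less_power)

lemma inverse_D_le: "n \<ge> 1 \<Longrightarrow> 1 / real (D n) \<le> 2 / 2 ^ n"
proof -
  assume n: "n \<ge> 1"
  have "real (2 ^ n) \<le> real (2 * D n)" using D_ge[OF n] by (simp only: of_nat_le_iff)
  then show ?thesis using D_pos[OF n] by (simp add: field_simps)
qed

lemma divide_D_le: "n \<ge> 1 \<Longrightarrow> c \<ge> 0 \<Longrightarrow> c / real (D n) \<le> 2 * c / 2 ^ n"
  using mult_left_mono[OF inverse_D_le, of n c] by (simp add: mult_ac)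

lemma g_nonneg: "g n z \<ge> 0"
  by (simp add: g_def disc_green_nonneg)

lemma continuous_on_g: "continuous_on S (g n)"
proof -
  have "continuous_on S (\<lambda>z. disc_green R (poly (comp_poly p n) z) / real (D n))"
    by (cases "D n = 0") (auto intro!: continuous_intros
        continuous_on_compose2[OF continuous_on_disc_green[OF R_pos, of UNIV]])
  then show ?thesis by (simp add: g_def[abs_def] poly_comp_poly)
qed

lemma g_eq_0_iff: "n \<ge> 1 \<Longrightarrow> g n z = 0 \<longleftrightarrow> norm (poly_iter p n z) \<le> R"
  using D_pos[of n] disc_green_eq_0_iff[OF R_pos] by (auto simp: g_def)

text \<open>The two estimates for \<open>disc_green R\<close>, applied at \<open>poly_iter p n z\<close> and divided by \<open>D n\<close>. The
  monotonicity is the gain from the choice of \<open>R\<close>: it makes the limit positive wherever some \<open>g n\<close>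
  is.\<close>

lemma g_Suc_bounds:
  assumes n: "n \<ge> 1"
  shows "g n z \<le> g (Suc n) z" and "g (Suc n) z \<le> g n z + 2 * M / 2 ^ n"
proof -
  let ?w = "poly_iter p n z" and ?d = "real (degree (p (Suc n)))"
  have eq: "g (Suc n) z = (disc_green R (poly (p (Suc n)) ?w) / ?d) / real (D n)"
    by (simp add: g_def D_Suc)
  show "g n z \<le> g (Suc n) z"
    unfolding eq using disc_green_poly_ge[of "Suc n" ?w] n
    by (simp only: g_def) (rule divide_right_mono, auto)
  have "g (Suc n) z \<le> (disc_green R ?w + M) / real (D n)"
    unfolding eq using disc_green_poly_le[of "Suc n" ?w] by (intro divide_right_mono) auto
  also have "\<dots> = g n z + M / real (D n)" by (simp add: g_def add_divide_distrib)
  also have "\<dots> \<le> g n z + 2 * M / 2 ^ n" using divide_D_le[OF n M_nonneg] by simp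
  finally show "g (Suc n) z \<le> g n z + 2 * M / 2 ^ n" .
qed

lemma g_mono: "1 \<le> n \<Longrightarrow> n \<le> m \<Longrightarrow> g n z \<le> g m z"
  by (rule dec_induct[of n m]) (auto intro: order_trans[OF _ g_Suc_bounds(1)])

lemma g_le: 
  assumes "1 \<le> n" "n \<le> m"
  shows "g m z \<le> g n z + 4 * M / 2 ^ n"
proof -
  have "g m z + 4 * M / 2 ^ m \<le> g n z + 4 * M / 2 ^ n"
    using assms(2)
  proof (induction m rule: dec_induct)
    case (step m)
    have "4 * M / 2 ^ Suc m = 2 * M / 2 ^ m" "4 * M / 2 ^ m = 2 * (2 * M / 2 ^ m)" by simp_all
    then show ?case using step g_Suc_bounds(2)[of m z] assms(1) by linarith
  qed simp
  moreover have "4 * M / 2 ^ m \<ge> 0" using M_nonneg by simp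
  ultimately show ?thesis by linarith
qed

lemma g_tendsto_escape_rate: "(\<lambda>n. g n z) \<longlonglongrightarrow> escape_rate z"
proof -
  have "incseq (\<lambda>n. g (Suc n) z)" using g_Suc_bounds(1) by (intro incseq_SucI) auto
  moreover have "g (Suc n) z \<le> g 1 z + 4 * M / 2 ^ 1" for n by (rule g_le) auto
  ultimately obtain L where "(\<lambda>n. g (Suc n) z) \<longlonglongrightarrow> L" by (meson incseq_convergent)
  then have "(\<lambda>n. g n z) \<longlonglongrightarrow> L" by (rule LIMSEQ_imp_Suc)
  then show ?thesis by (simp add: escape_rate_def limI)
qed

lemma g_le_escape_rate: "n \<ge> 1 \<Longrightarrow> g n z \<le> escape_rate z"
  by (rule LIMSEQ_le_const[OF g_tendsto_escape_rate]) (use g_mono in blast)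

lemma escape_rate_le: "n \<ge> 1 \<Longrightarrow> escape_rate z \<le> g n z + 4 * M / 2 ^ n"
  by (rule LIMSEQ_le_const2[OF g_tendsto_escape_rate]) (use g_le in blast)

lemma uniform_limit_escape_rate: "uniform_limit UNIV g escape_rate sequentially"
proof (rule uniform_limitI)
  fix e :: real assume "e > 0"
  have "eventually (\<lambda>n. 4 * M / 2 ^ n < e) sequentially"
    using order_tendstoD(2)[OF LIMSEQ_divide_realpow_zero[of 2 "4 * M"] \<open>e > 0\<close>] by simp
  with eventually_ge_at_top[of 1]
  show "\<forall>\<^sub>F n in sequentially. \<forall>z\<in>UNIV. dist (g n z) (escape_rate z) < e"
  proof eventually_elim
    case (elim n)
    then show ?case using g_le_escape_rate[of n] escape_rate_le[of n]
      by (auto simp: dist_real_def abs_le_iff intro!: order.strict_trans1[OF _ elim(2)])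
        (smt (verit))+
  qed
qed

lemma continuous_on_escape_rate: "continuous_on S escape_rate"
  by (rule continuous_on_subset[OF uniform_limit_theorem[OF always_eventually uniform_limit_escape_rate]])
    (auto simp: continuous_on_g)

lemma escape_rate_nonneg: "escape_rate z \<ge> 0"
  using g_le_escape_rate[of 1 z] g_nonneg[of 1 z] by simp

lemma escape_rate_eq_0_iff: "escape_rate z = 0 \<longleftrightarrow> (\<forall>n\<ge>1. norm (poly_iter p n z) \<le> R)"
proof
  assume "escape_rate z = 0"
  then show "\<forall>n\<ge>1. norm (poly_iter p n z) \<le> R"
    using g_le_escape_rate g_nonneg g_eq_0_iff by (metis antisym)
next
  assume *: "\<forall>n\<ge>1. norm (poly_iter p n z) \<le> R"
  have "(\<lambda>n. g n z) \<longlonglongrightarrow> 0"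
    by (rule tendsto_eventually, rule eventually_mono[OF eventually_ge_at_top[of 1]])
      (use * g_eq_0_iff in auto)
  then show "escape_rate z = 0" using LIMSEQ_unique[OF g_tendsto_escape_rate] by blast
qed

text \<open>Along a bounded orbit \<open>g n\<close> is a bounded quantity divided by the unbounded degree \<open>D n\<close>.\<close>

lemma filled_julia_eq: "filled_julia p = {z. escape_rate z = 0}"
proof (intro equalityI subsetI CollectI)
  fix z assume "z \<in> filled_julia p"
  then obtain B where B: "\<And>n. n \<ge> 1 \<Longrightarrow> norm (poly_iter p n z) \<le> B"
    by (auto simp: filled_julia_def bounded_iff)
  define C where "C = disc_green R (of_real B)"
  have C: "C \<ge> 0" by (simp add: C_def disc_green_nonneg)
  have le: "g n z \<le> 2 * C / 2 ^ n" if "n \<ge> 1" for n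
  proof -
    have "norm (poly_iter p n z) \<le> norm (of_real B :: complex)" using B[OF that] by simp
    then have "disc_green R (poly_iter p n z) \<le> C"
      unfolding C_def by (rule disc_green_le[OF R_pos])
    then have "g n z \<le> C / real (D n)" unfolding g_def by (intro divide_right_mono) auto
    with divide_D_le[OF that C] show ?thesis by simp
  qed
  have "escape_rate z \<le> 0"
    by (rule LIMSEQ_le[OF g_tendsto_escape_rate LIMSEQ_divide_realpow_zero[of 2 "2 * C"]])
      (use le in auto)
  then show "escape_rate z = 0" using escape_rate_nonneg[of z] by simp
next
  fix z assume "z \<in> {z. escape_rate z = 0}"
  then show "z \<in> filled_julia p"
    unfolding filled_julia_def bounded_iff using escape_rate_eq_0_iff by auto
qed

lemma g_at_infinity:
  assumes n: "n \<ge> 1"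
  obtains c where "((\<lambda>z. g n z - ln (norm z)) \<longlongrightarrow> c) at_infinity"
proof -
  have d: "degree (comp_poly p n) \<ge> 1" using D_pos[OF n] .
  have "((\<lambda>z. ln (norm (poly (comp_poly p n) z)) / real (D n) - ln (norm z) - ln R / real (D n))
      \<longlongrightarrow> ln (norm (lead_coeff (comp_poly p n))) / real (D n) - ln R / real (D n)) at_infinity"
    by (intro tendsto_diff tendsto_const ln_norm_poly_tendsto d)
  moreover have "\<forall>\<^sub>F z in at_infinity. ln (norm (poly (comp_poly p n) z)) / real (D n) - ln (norm z)
      - ln R / real (D n) = g n z - ln (norm z)"
  proof -
    have "eventually (\<lambda>z. norm (poly (comp_poly p n) z) \<ge> R) at_infinity"
      using filterlim_compose[OF filterlim_norm_at_top poly_at_infinity[OF d]]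
      by (simp add: filterlim_at_top)
    then show ?thesis
      by eventually_elim
        (simp add: g_def poly_comp_poly disc_green_outside R_pos diff_divide_distrib)
  qed
  ultimately show ?thesis by (rule that[OF Lim_transform_eventually])
qed

text \<open>Uniform convergence allows the limits \<open>n \<rightarrow> \<infinity>\<close> and \<open>z \<rightarrow> \<infinity>\<close> to be interchanged, once the
  constants \<open>c n\<close> of the \<open>g n\<close> converge; they inherit monotonicity and boundedness from \<open>g\<close>.\<close>

lemma escape_rate_at_infinity: "\<exists>c. ((\<lambda>z. escape_rate z - ln (norm z)) \<longlongrightarrow> c) at_infinity"
proof -
  have "\<forall>n. \<exists>c. ((\<lambda>z. g (Suc n) z - ln (norm z)) \<longlongrightarrow> c) at_infinity"
    using g_at_infinity by (metis le_add1 plus_1_eq_Suc)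
  then obtain c where c: "\<And>n. ((\<lambda>z. g (Suc n) z - ln (norm z)) \<longlongrightarrow> c n) at_infinity" by metis
  have "incseq c"
  proof (rule incseq_SucI)
    show "c n \<le> c (Suc n)" for n
      by (rule tendsto_le[OF _ c[of "Suc n"] c[of n]]) (use g_Suc_bounds(1)[of "Suc n"] trivial_limit_at_infinity in auto)
  qed
  moreover have "c n \<le> c 0 + 2 * M" for n
  proof (rule tendsto_le[OF _ tendsto_add[OF c[of 0] tendsto_const[of "2 * M"]] c[of n]])
    have "g (Suc n) z \<le> g 1 z + 2 * M" for z using g_le[of 1 "Suc n" z] by simp
    then show "\<forall>\<^sub>F z in at_infinity. g (Suc n) z - ln (norm z) \<le> g (Suc 0) z - ln (norm z) + 2 * M"
      by (simp add: algebra_simps)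
  qed (rule trivial_limit_at_infinity)
  ultimately obtain l where l: "c \<longlonglongrightarrow> l" by (meson incseq_convergent)
  have "uniform_limit UNIV (\<lambda>n. g (Suc n)) escape_rate sequentially"
    using filterlim_compose[OF uniform_limit_escape_rate filterlim_Suc] .
  then have "uniform_limit UNIV (\<lambda>n z. g (Suc n) z - ln (norm z))
      (\<lambda>z. escape_rate z - ln (norm z)) sequentially"
    by (intro uniform_limit_intros)
  from swap_uniform_limit'[OF always_eventually l this] c show ?thesis by auto
qed

lemma escape_rate_nonzero_imp:
  assumes "escape_rate z \<noteq> 0"
  obtains n where "n \<ge> 1" "norm (poly_iter p n z) > R"
  using assms escape_rate_eq_0_iff[of z] by (auto simp: not_le)

text \<open>Near a point with \<open>g n\<^sub>0 > 0\<close> all later \<open>g n\<close> are of the form \<open>ln \<bar>F n\<bar>\<close> with a holomorphic branch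
  \<open>F n\<close> of \<open>(P\<^sub>n / R)\<^bsup>1/D n\<^esup>\<close>. These branches are locally bounded, and by Montel's theorem a
  subsequence converges to a holomorphic function of modulus \<open>exp escape_rate\<close>.\<close>

lemma escape_rate_locally_ln_norm:
  assumes "escape_rate z \<noteq> 0"
  shows "\<exists>e>0. \<exists>\<Phi>. ball z e \<subseteq> {z. escape_rate z \<noteq> 0} \<and> \<Phi> holomorphic_on ball z e \<and>
      (\<forall>w\<in>ball z e. \<Phi> w \<noteq> 0 \<and> escape_rate w = ln (norm (\<Phi> w)))"
proof -
  obtain k where k: "k \<ge> 1" "norm (poly_iter p k z) > R"
    using escape_rate_nonzero_imp[OF assms] .
  have "open {z. norm (poly (comp_poly p k) z) > R}"
    by (intro open_Collect_less continuous_intros)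
  with k obtain e where e: "e > 0" "ball z e \<subseteq> {z. norm (poly (comp_poly p k) z) > R}"
    unfolding open_contains_ball by (auto simp: poly_comp_poly)
  have big: "norm (poly_iter p n w) > R" if "w \<in> ball z e" "n \<ge> k" for w n
  proof -
    have "g k w \<noteq> 0" using e that k(1) by (auto simp: g_eq_0_iff poly_comp_poly)
    then have "g n w \<noteq> 0" using g_mono[OF k(1) that(2), of w] g_nonneg[of k w] by linarith
    then show ?thesis using that k(1) by (simp add: g_eq_0_iff)
  qed
  have "\<exists>F. F holomorphic_on ball z e \<and> (\<forall>w\<in>ball z e. norm (F w) = exp (g n w))" if n: "n \<ge> k" for n
  proof -
    have n1: "n \<ge> 1" using n k(1) by simp
    have "simply_connected (ball z e)" by (simp add: convex_imp_simply_connected)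
    moreover have "(\<lambda>w. poly (comp_poly p n) w / of_real R) holomorphic_on ball z e"
      using R_pos by (auto intro!: holomorphic_intros)
    moreover have "\<forall>w\<in>ball z e. poly (comp_poly p n) w / of_real R \<noteq> 0"
      using big[OF _ n] R_pos by (fastforce simp: poly_comp_poly)
    ultimately obtain l where l: "l holomorphic_on ball z e"
      "\<And>w. w \<in> ball z e \<Longrightarrow> poly (comp_poly p n) w / of_real R = exp (l w)"
      using simply_connected_eq_holomorphic_log[OF open_ball] by blast
    have "norm (exp (l w / of_nat (D n))) = exp (g n w)" if w: "w \<in> ball z e" for w
    proof -
      have "exp (Re (l w)) = norm (poly_iter p n w) / R"
        using arg_cong[OF l(2)[OF w], of norm] R_pos by (simp add: norm_divide poly_comp_poly)
      then have "Re (l w) = ln (norm (poly_iter p n w) / R)" by (metis ln_exp)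
      also have "\<dots> = disc_green R (poly_iter p n w)"
        using big[OF w n] R_pos by (simp add: disc_green_def max_def)
      finally show ?thesis by (simp add: g_def)
    qed
    moreover have "(\<lambda>w. exp (l w / of_nat (D n))) holomorphic_on ball z e"
      using l(1) D_pos[OF n1] by (auto intro!: holomorphic_intros)
    ultimately show ?thesis by blast
  qed
  then have "\<forall>n. \<exists>F. F holomorphic_on ball z e \<and> (\<forall>w\<in>ball z e. norm (F w) = exp (g (k + n) w))"
    by simp
  then obtain F where F: "\<And>n. F n holomorphic_on ball z e"
    "\<And>n w. w \<in> ball z e \<Longrightarrow> norm (F n w) = exp (g (k + n) w)" by metis
  have bdd: "\<exists>B. \<forall>h\<in>range F. \<forall>w\<in>S. norm (h w) \<le> B" if "compact S" "S \<subseteq> ball z e" for S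
  proof -
    have "bounded (escape_rate ` S)"
      using that(1) continuous_on_escape_rate by (intro compact_imp_bounded compact_continuous_image)
    then obtain B where B: "\<And>w. w \<in> S \<Longrightarrow> \<bar>escape_rate w\<bar> \<le> B" by (auto simp: bounded_iff)
    have "norm (F n w) \<le> exp B" if w: "w \<in> S" for n w
      using F(2)[of w n] w \<open>S \<subseteq> ball z e\<close> g_le_escape_rate[of "k + n" w] k(1) B[OF w] by auto
    then show ?thesis by blast
  qed
  have hol: "h holomorphic_on ball z e" if "h \<in> range F" for h using that F(1) by auto
  obtain \<Phi> s where \<Phi>: "\<Phi> holomorphic_on ball z e" "strict_mono (s :: nat \<Rightarrow> nat)"
    "\<And>w. w \<in> ball z e \<Longrightarrow> (\<lambda>n. F (s n) w) \<longlonglongrightarrow> \<Phi> w"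
    by (rule Montel[OF open_ball hol bdd subset_refl]) (use that in blast)+
  have eq: "norm (\<Phi> w) = exp (escape_rate w)" if w: "w \<in> ball z e" for w
  proof -
    have "(\<lambda>n. norm (F (s n) w)) \<longlonglongrightarrow> norm (\<Phi> w)" using \<Phi>(3)[OF w] by (rule tendsto_norm)
    moreover have "(\<lambda>n. exp (g (k + s n) w)) \<longlonglongrightarrow> exp (escape_rate w)"
    proof (intro tendsto_exp filterlim_compose[OF g_tendsto_escape_rate])
      show "filterlim (\<lambda>n. k + s n) sequentially sequentially"
        using \<Phi>(2) by (intro filterlim_subseq) (simp add: strict_mono_def)
    qed
    ultimately show ?thesis using F(2)[OF w] LIMSEQ_unique by (metis (no_types, lifting) ext)
  qed
  have "\<Phi> w \<noteq> 0 \<and> escape_rate w = ln (norm (\<Phi> w))" if "w \<in> ball z e" for w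
    using eq[OF that] by auto
  moreover have "escape_rate w \<noteq> 0" if "w \<in> ball z e" for w
    using big[OF that order.refl] k(1) escape_rate_eq_0_iff[of w] by (auto simp: not_le)
  ultimately show ?thesis using e(1) \<Phi>(1) by blast
qed

lemma extended_green_escape_rate: "extended_green (filled_julia p) escape_rate"
  unfolding extended_green_def
proof (intro conjI ballI)
  have eq: "- filled_julia p = {z. escape_rate z \<noteq> 0}" by (auto simp: filled_julia_eq)
  have "open {z. escape_rate z \<noteq> 0}"
    by (intro open_Collect_neq continuous_on_escape_rate continuous_intros)
  then show "harmonic_on escape_rate (- filled_julia p)"
    unfolding eq using escape_rate_locally_ln_norm by (intro harmonic_on_if_locally_ln_norm) auto
  show "escape_rate z > 0" if "z \<in> - filled_julia p" for z
    using that escape_rate_nonneg[of z] by (simp add: filled_julia_eq)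
qed (use continuous_on_escape_rate escape_rate_at_infinity in \<open>auto simp: filled_julia_eq\<close>)

lemma compact_filled_julia: "compact (filled_julia p)"
proof -
  have "closed (filled_julia p)"
    unfolding filled_julia_eq by (intro closed_Collect_eq continuous_on_escape_rate continuous_intros)
  moreover have "bounded (filled_julia p)"
  proof -
    have "eventually (\<lambda>z. escape_rate z > 0) at_infinity"
      using extended_green_at_top[OF extended_green_escape_rate] by (simp add: filterlim_at_top_dense)
    then have "eventually (\<lambda>z. \<not> escape_rate z = 0) at_infinity"
      by eventually_elim simp
    then show ?thesis unfolding filled_julia_eq by (rule bounded_Collect_if_eventually_not)
  qed
  ultimately show ?thesis by (simp add: compact_eq_bounded_closed)
qed

text \<open>The compositions of the sequence themselves separate points outside from the set.\<close>

lemma polynomially_convex_filled_julia: "polynomially_convex (filled_julia p)"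
proof (rule polynomially_convexI)
  show "filled_julia p \<noteq> {}" using extended_green_nonempty[OF extended_green_escape_rate] .
  fix z assume "z \<notin> filled_julia p"
  then obtain n where "n \<ge> 1" "norm (poly_iter p n z) > R"
    using escape_rate_nonzero_imp by (auto simp: filled_julia_eq)
  moreover have "norm (poly_iter p n w) \<le> R" if "w \<in> filled_julia p" for w
    using that \<open>n \<ge> 1\<close> escape_rate_eq_0_iff by (auto simp: filled_julia_eq)
  ultimately show "\<exists>q B. (\<forall>w\<in>filled_julia p. norm (poly q w) \<le> B) \<and> B < norm (poly q z)"
    by (intro exI[of _ "comp_poly p n"] exI[of _ R]) (simp add: poly_comp_poly)
qed (rule compact_filled_julia)

lemma filled_julia_klimek_family: "filled_julia p \<in> klimek_family"
  using polynomially_convex_filled_julia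
    regular_compact_if_extended_green[OF polynomially_convex_filled_julia extended_green_escape_rate]
  by (simp add: klimek_family_iff)

text \<open>Pulling back by the \<open>n\<close>-th composition divides the distance between \<open>E\<close> and the disc by
  \<open>D n\<close>, so every \<open>E\<close> has the same limit as the disc.\<close>

lemma klimek_converges_filled_julia:
  assumes E: "E \<in> klimek_family"
  shows "klimek_converges (\<lambda>n. poly_iter p n -` E) (filled_julia p)"
proof -
  have fam: "poly_iter p n -` E \<in> klimek_family" if "n \<ge> 1" for n
    using poly_vimage_klimek_family(1)[OF D_pos[OF that] E] by (simp add: poly_iter_eq_poly)
  have green: "green (poly_iter p n -` E) z = green E (poly_iter p n z) / real (D n)"
    if "n \<ge> 1" for n z
    using poly_vimage_klimek_family(2)[OF D_pos[OF that] E] by (simp add: poly_iter_eq_poly)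
  have julia: "green (filled_julia p) = escape_rate"
    by (rule green_eqI[OF polynomially_convex_filled_julia extended_green_escape_rate])
  have "extended_green E (green E)" using E extended_green_green by (simp add: klimek_family_iff)
  then obtain C where C: "\<And>w. \<bar>green E w - disc_green R w\<bar> \<le> C"
    using extended_green_minus_disc_green_bounded R_pos by blast
  have "C \<ge> 0" using C[of 0] by linarith
  have bound: "\<bar>green (poly_iter p n -` E) z - green (filled_julia p) z\<bar> \<le> (2 * C + 4 * M) / 2 ^ n"
    if n: "n \<ge> 1" for n z
  proof -
    have "\<bar>green (poly_iter p n -` E) z - g n z\<bar>
        = \<bar>green E (poly_iter p n z) - disc_green R (poly_iter p n z)\<bar> / real (D n)"
      by (simp add: green[OF n] g_def diff_divide_distrib[symmetric])
    also have "\<dots> \<le> C / real (D n)" using C by (intro divide_right_mono) auto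
    also have "\<dots> \<le> 2 * C / 2 ^ n" using divide_D_le[OF n \<open>C \<ge> 0\<close>] .
    finally have "\<bar>green (poly_iter p n -` E) z - g n z\<bar> \<le> 2 * C / 2 ^ n" .
    moreover have "\<bar>g n z - escape_rate z\<bar> \<le> 4 * M / 2 ^ n"
      using g_le_escape_rate[OF n, of z] escape_rate_le[OF n, of z] by linarith
    ultimately show ?thesis unfolding julia add_divide_distrib by linarith
  qed
  have dist: "0 \<le> klimek_dist (poly_iter p n -` E) (filled_julia p) \<and>
      klimek_dist (poly_iter p n -` E) (filled_julia p) \<le> (2 * C + 4 * M) / 2 ^ n" if n: "n \<ge> 1" for n
  proof
    have "bdd_above (range (\<lambda>z. \<bar>green (poly_iter p n -` E) z - green (filled_julia p) z\<bar>))"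
      using bound[OF n] by (auto simp: bdd_above_def)
    from cSUP_upper2[OF this UNIV_I abs_ge_zero]
    show "0 \<le> klimek_dist (poly_iter p n -` E) (filled_julia p)" by (simp add: klimek_dist_def)
    show "klimek_dist (poly_iter p n -` E) (filled_julia p) \<le> (2 * C + 4 * M) / 2 ^ n"
      unfolding klimek_dist_def using bound[OF n] by (intro cSUP_least) auto
  qed
  have "(\<lambda>n. klimek_dist (poly_iter p n -` E) (filled_julia p)) \<longlonglongrightarrow> 0"
    by (rule tendsto_sandwich[OF _ _ tendsto_const LIMSEQ_divide_realpow_zero[of 2 "2 * C + 4 * M"]])
      (use dist in \<open>auto intro!: eventually_mono[OF eventually_ge_at_top[of 1]]\<close>)
  with fam filled_julia_klimek_family show ?thesis by (simp add: klimek_converges_def)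
qed

end

section \<open>Convergence to the filled Julia set\<close>

theorem mainTheorem1:
  fixes p :: "nat \<Rightarrow> complex poly" and \<alpha> r :: real and h :: "complex \<Rightarrow> real"
  assumes deg_1: "degree (p 1) \<ge> 1"
    and deg_ge_2: "\<And>n. n \<ge> 2 \<Longrightarrow> degree (p n) \<ge> 2"
    and alpha: "ereal \<alpha> = limsup (\<lambda>n. ereal (1 / real (degree (p n))))"
    and r_pos: "r > 0"
    and h_growth: "filterlim (\<lambda>z. h z - \<alpha> * ln (norm z)) at_top at_infinity"
    and zeros: "(\<Union>n\<in>{1..}. poly (p n) -` {0}) \<subseteq> cball 0 r"
    and lower_bound: "\<exists>N>1. \<forall>n\<ge>N. \<forall>\<zeta>\<in>- cball 0 r.
           1 / real (degree (p n)) * log_plus (norm (poly (p n) \<zeta>)) > h \<zeta>"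
    and bounded_on_open: "\<exists>D. open D \<and> D \<noteq> {} \<and>
           (\<forall>z\<in>D. bdd_above ((\<lambda>n. 1 / real (degree (p n)) * log_plus (norm (poly (p n) z))) ` {1..}))"
  shows "(\<forall>E. compact E \<and> polynomially_convex E \<and> regular_compact E \<longrightarrow>
            klimek_converges (\<lambda>n. poly_iter p n -` E) (filled_julia p)) \<and>
         filled_julia p \<noteq> {} \<and> compact (filled_julia p) \<and>
         regular_compact (filled_julia p) \<and> polynomially_convex (filled_julia p)"
proof -
  have deg: "degree (p n) \<ge> 1" if "n \<ge> 1" for n
    using that deg_1 deg_ge_2[of n] by (cases "n = 1") auto
  have zeros': "norm z \<le> r" if "n \<ge> 1" "poly (p n) z = 0" for n z
    using zeros that by (auto simp: subset_iff)
  have "ereal \<alpha> \<ge> 0" unfolding alpha by (rule le_Limsup) auto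
  then have \<alpha>: "\<alpha> \<ge> 0" by simp
  have "eventually (\<lambda>z. h z - \<alpha> * ln (norm z) > 0) at_infinity"
    using h_growth unfolding filterlim_at_top_dense by blast
  then obtain b where b: "\<And>z. norm z \<ge> b \<Longrightarrow> h z - \<alpha> * ln (norm z) > 0"
    by (auto simp: eventually_at_infinity)
  \<comment> \<open>As \<open>\<alpha> \<ge> 0\<close>, the growth of \<open>h\<close> provides a point outside the disc at which \<open>h\<close> is positive.\<close>
  define \<zeta> :: complex where "\<zeta> = of_real (max b (max 1 (r + 1)))"
  have norm: "norm \<zeta> = max b (max 1 (r + 1))" unfolding \<zeta>_def norm_of_real by simp
  have "\<alpha> * ln (norm \<zeta>) \<ge> 0" using \<alpha> norm by (intro mult_nonneg_nonneg) auto
  with b[of \<zeta>] norm have h: "h \<zeta> > 0" by simp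
  have "\<zeta> \<in> - cball 0 r" using norm by simp
  with lower_bound obtain N where "\<And>n. n \<ge> N \<Longrightarrow>
      1 / real (degree (p n)) * log_plus (norm (poly (p n) \<zeta>)) > h \<zeta>" by blast
  with h have pos: "1 / real (degree (p n)) * log_plus (norm (poly (p n) \<zeta>)) > 0" if "n \<ge> N" for n
    using that less_trans by blast
  obtain D where D: "open D" "D \<noteq> {}" "\<And>z. z \<in> D \<Longrightarrow>
      bdd_above ((\<lambda>n. 1 / real (degree (p n)) * log_plus (norm (poly (p n) z))) ` {1..})"
    using bounded_on_open by (elim exE conjE) (rule that, assumption+, erule (1) bspec)
  obtain A where "A \<ge> 1" "\<And>n. n \<ge> 1 \<Longrightarrow> norm (lead_coeff (p n)) \<le> A ^ degree (p n)"
    "\<And>n. n \<ge> 1 \<Longrightarrow> 1 \<le> A ^ degree (p n) * norm (lead_coeff (p n))"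
  proof (rule lead_coeff_bounds[of p r N \<zeta> D])
    show "degree (p n) \<ge> 1" if "n \<ge> 1" for n using that by (rule deg)
    show "norm z \<le> r" if "n \<ge> 1" "poly (p n) z = 0" for n z using that by (rule zeros')
    show "1 / real (degree (p n)) * log_plus (norm (poly (p n) \<zeta>)) > 0" if "n \<ge> N" for n
      using that by (rule pos)
    show "bdd_above ((\<lambda>n. 1 / real (degree (p n)) * log_plus (norm (poly (p n) z))) ` {1..})"
      if "z \<in> D" for z using that by (rule D(3))
  qed (rule r_pos, rule D(1), rule D(2), rule that)
  then interpret coefficient_bounded_sequence p r A
    using deg_1 deg_ge_2 zeros' r_pos by unfold_locales auto
  have "klimek_converges (\<lambda>n. poly_iter p n -` E) (filled_julia p)"
    if "polynomially_convex E" "regular_compact E" for E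
    using that by (intro klimek_converges_filled_julia) (simp add: klimek_family_iff)
  then show ?thesis
    using filled_julia_klimek_family extended_green_nonempty[OF extended_green_escape_rate]
      compact_filled_julia by (auto simp: klimek_family_iff)
qed

end
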